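(* Let $\mathbb F$ be a field, $G$ a digraph without multisquares, and $n\ge 0$. For each thick bipartite $\mathcal S_n$-class $c$ choose a partition $c=c^+\sqcup c^-$ such that there are no short moves between elements inside $c^+$ and no short moves between elements inside $c^-$, and set $s_c=\sum_{p\in c^+}e_p-\sum_{p\in c^-}e_p$. If $\mathrm{char}(\mathbb F)=2$, for each thick $\mathcal S_n$-class $c$ (not necessarily bipartite) set $s'_c=\sum_{p\in c}e_p$. Then the following statements hold: (1) If $\mathrm{char}(\mathbb F)=2$, then the elements of the form $s'_c$, where $c$ runs over all thick $\mathcal S_n$-classes, form a basis of $\Omega_n(G;\mathbb F)$. (2) If $\mathrm{char}(\mathbb F)\ne2$, then the elements of the form $s_c$, where $c$ runs over all thick bipartite $\mathcal S_n$-classes, form a basis of $\Omega_n(G;\mathbb F)$. Moreover, these bases are dual, with respect to the non-degenerate bilinear form $\langle-,-\rangle:\Omega_n(G;\mathbb F)\times(\mathbb FG/T)^n\to\mathbb F$, $\langle\sum_p\alpha_pe_p,q+T^n\rangle=\sum_p\alpha_p\delta_{p,q}$, to the following bases of $\Omega^n(G;\mathbb F)\cong(\mathbb FG/T)^n$: in case (1), the basis given by (the images of) a complete set of representatives of the thick $\mathcal S_n$-classes; in case (2), the basis given by (the images of) a complete set of representatives of the thick bipartite $\mathcal S_n$-classes.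
   Context: A digraph $G$ consists of a finite set $V(G)$ of vertices and a set of arrows, which are ordered pairs of distinct vertices. An $n$-path is a sequence $(p_0,\dots,p_n)$ of vertices such that $(p_i,p_{i+1})$ is an arrow for $0\le i\le n-1$. $d(x,y)$ is the directed distance; $d(x,y)=2$ means that $x\ne y$, there is no arrow $x\to y$, and there is a $2$-path from $x$ to $y$. $G$ has no multisquares if for all $x,y$ with $d(x,y)=2$ there are at most two $2$-paths from $x$ to $y$. Let $\mathcal R_n(G;\mathbb F)$ be the vector space with basis $e_{x_0,\dots,x_n}$, $x_i\in V(G)$, $x_i\ne x_{i+1}$, with differential $\partial(e_{x_0,\dots,x_n})=\sum_{i=0}^n(-1)^ie_{x_0,\dots,\hat x_i,\dots,x_n}$, symbols with equal consecutive indices being $0$. Let $\mathcal A_n(G;\mathbb F)$ be the span of $e_p$ for $n$-paths $p$. Then $\Omega_n(G;\mathbb F)=\mathcal A_n(G;\mathbb F)\cap\partial^{-1}(\mathcal A_{n-1}(G;\mathbb F))$. $\mathbb FG$ is the path algebra: it has basis all paths of length $n\ge0$, graded by length, with product given by concatenation $(x_0,\dots,x_n)(y_0,\dots,y_m)=(x_0,\dots,x_n,y_1,\dots,y_m)$ if $x_n=y_0$ and $0$ otherwise. $T\triangleleft\mathbb FG$ is the two-sided ideal generated by $t_{x,y}=\sum_v(x,v,y)$ (sum over all $2$-paths from $x$ to $y$) for all $x,y$ with $d(x,y)=2$, and $T^n=T\cap(\mathbb FG)^n$. The path cochain algebra $\Omega^\bullet(G;\mathbb F)$ is identified with $\mathbb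 FG/T$. $\delta_{p,q}$ is the Kronecker delta. Two distinct $n$-paths $p,q$ differ by a short move if there is $1\le i\le n-1$ with $p_j=q_j$ for all $j\ne i$ and $d(p_{i-1},p_{i+1})=2$. The graph $\mathcal S_n$ is the undirected simple graph whose vertices are the $n$-paths of $G$, with an edge between two distinct $n$-paths that differ by a short move. Its connected components (viewed also as sets of $n$-paths) are the $\mathcal S_n$-classes. A pair $(x,y)$ with $d(x,y)=2$ is thin if there is exactly one $2$-path from $x$ to $y$. An $n$-path $p$ is thin if some pair $(p_{i-1},p_{i+1})$, $0<i<n$, is thin (in particular with $d(p_{i-1},p_{i+1})=2$). An $\mathcal S_n$-class is thin if it contains a thin path, and thick otherwise. An $\mathcal S_n$-class is bipartite if it is bipartite as a graph. A complete set of representatives contains exactly one path from each class in question.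
   Formalization: In case (2), exact duality fails when a representative q lies in c^- (the pairing is then -1); the formal statement gives the pairing +1, -1 or 0 for every complete set of representatives, and exact duality when all representatives lie in the chosen c^+. *)

theory Defs
  imports
    "Graph_Theory.Pair_Digraph"
    "Jordan_Normal_Form.VS_Connect"
    "HOL-Library.Poly_Mapping"
    "HOL-Algebra.QuotRing"
begin

text \<open>
  A digraph (finite vertex set, arrows are ordered pairs of distinct vertices) is an object
  satisfying \<^const>\<open>pair_digraph\<close>. A sequence of vertices is a list, so that an
  \<open>n\<close>-path is a list of length \<open>n + 1\<close> and a vertex is a \<open>0\<close>-path.
\<close>

definition n_paths :: "'a pair_pre_digraph \<Rightarrow> nat \<Rightarrow> 'a list set" where
  "n_paths G n =
    {p. length p = n + 1 \<and> set p \<subseteq> pverts G \<and> (\<forall>i<n. (p ! i, p ! (i + 1)) \<in> parcs G)}"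

definition two_paths :: "'a pair_pre_digraph \<Rightarrow> 'a \<Rightarrow> 'a \<Rightarrow> 'a list set" where
  "two_paths G x y = {p \<in> n_paths G 2. hd p = x \<and> last p = y}"

definition dist_two :: "'a pair_pre_digraph \<Rightarrow> 'a \<Rightarrow> 'a \<Rightarrow> bool" where
  "dist_two G x y \<longleftrightarrow> x \<noteq> y \<and> (x, y) \<notin> parcs G \<and> two_paths G x y \<noteq> {}"

definition no_multisquares :: "'a pair_pre_digraph \<Rightarrow> bool" where
  "no_multisquares G \<longleftrightarrow> (\<forall>x y. dist_two G x y \<longrightarrow> card (two_paths G x y) \<le> 2)"

definition thin_pair :: "'a pair_pre_digraph \<Rightarrow> 'a \<Rightarrow> 'a \<Rightarrow> bool" where
  "thin_pair G x y \<longleftrightarrow> dist_two G x y \<and> card (two_paths G x y) = 1"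

definition thin_path :: "'a pair_pre_digraph \<Rightarrow> nat \<Rightarrow> 'a list \<Rightarrow> bool" where
  "thin_path G n p \<longleftrightarrow>
    p \<in> n_paths G n \<and> (\<exists>i. 0 < i \<and> i < n \<and> thin_pair G (p ! (i - 1)) (p ! (i + 1)))"

definition short_moves :: "'a pair_pre_digraph \<Rightarrow> nat \<Rightarrow> ('a list \<times> 'a list) set" where
  "short_moves G n =
    {(p, q). p \<in> n_paths G n \<and> q \<in> n_paths G n \<and> p \<noteq> q \<and>
      (\<exists>i. 0 < i \<and> i < n \<and> (\<forall>j\<le>n. j \<noteq> i \<longrightarrow> p ! j = q ! j) \<and>
           dist_two G (p ! (i - 1)) (p ! (i + 1)))}"

text \<open>
  The relation \<^const>\<open>short_moves\<close> is symmetric, since \<open>p\<close> and \<open>q\<close> agree at the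
  positions \<open>i - 1\<close> and \<open>i + 1\<close>; hence the connected components are the classes of
  its reflexive transitive closure.
\<close>

definition s_classes :: "'a pair_pre_digraph \<Rightarrow> nat \<Rightarrow> 'a list set set" where
  "s_classes G n = n_paths G n // Restr ((short_moves G n)\<^sup>*) (n_paths G n)"

definition thick_classes :: "'a pair_pre_digraph \<Rightarrow> nat \<Rightarrow> 'a list set set" where
  "thick_classes G n = {c \<in> s_classes G n. \<not> (\<exists>p\<in>c. thin_path G n p)}"

definition bipartition ::
  "'a pair_pre_digraph \<Rightarrow> nat \<Rightarrow> 'a list set \<Rightarrow> 'a list set \<Rightarrow> 'a list set \<Rightarrow> bool" where
  "bipartition G n c A B \<longleftrightarrow> A \<union> B = c \<and> A \<inter> B = {} \<and>
    (\<forall>p\<in>A. \<forall>q\<in>A. (p, q) \<notin> short_moves G n) \<and>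
    (\<forall>p\<in>B. \<forall>q\<in>B. (p, q) \<notin> short_moves G n)"

definition bipartite_class :: "'a pair_pre_digraph \<Rightarrow> nat \<Rightarrow> 'a list set \<Rightarrow> bool" where
  "bipartite_class G n c \<longleftrightarrow> (\<exists>A B. bipartition G n c A B)"

definition thick_bipartite_classes :: "'a pair_pre_digraph \<Rightarrow> nat \<Rightarrow> 'a list set set" where
  "thick_bipartite_classes G n = {c \<in> thick_classes G n. bipartite_class G n c}"

definition complete_representatives :: "'b set set \<Rightarrow> 'b set \<Rightarrow> bool" where
  "complete_representatives C R \<longleftrightarrow> R \<subseteq> \<Union>C \<and> (\<forall>c\<in>C. \<exists>!q. q \<in> R \<inter> c)"

text \<open>
  A formal linear combination of vertex sequences with coefficients in the field \<open>'f\<close> is an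
  element of \<^typ>\<open>'a list \<Rightarrow>\<^sub>0 'f\<close>. Subspaces and quotients are module records over
  \<^const>\<open>class_ring\<close>, the field type \<open>'f\<close> viewed as a ring record; the
  multiplicative part of these records is not used.
\<close>

abbreviation basis_elem :: "'b \<Rightarrow> 'b \<Rightarrow>\<^sub>0 'f::field" where
  "basis_elem p \<equiv> Poly_Mapping.single p 1"

definition scale :: "'f::field \<Rightarrow> ('b \<Rightarrow>\<^sub>0 'f) \<Rightarrow> ('b \<Rightarrow>\<^sub>0 'f)" where
  "scale c f = Poly_Mapping.map ((*) c) f"

definition supported_on :: "'b set \<Rightarrow> ('b \<Rightarrow>\<^sub>0 'f::field) set" where
  "supported_on S = {f. Poly_Mapping.keys f \<subseteq> S}"

definition subspace_of :: "('b \<Rightarrow>\<^sub>0 'f::field) set \<Rightarrow> ('f, 'b \<Rightarrow>\<^sub>0 'f) module" where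
  "subspace_of W =
    \<lparr>carrier = W, mult = undefined, one = undefined, zero = 0, add = (+), smult = scale\<rparr>"

definition quotient_space :: "('f, 'b) module \<Rightarrow> 'b set \<Rightarrow> ('f, 'b set) module" where
  "quotient_space M W =
    \<lparr>carrier = a_rcosets\<^bsub>M\<^esub> W, mult = undefined, one = undefined, zero = W,
     add = set_add M, smult = (\<lambda>c X. \<Union>x\<in>X. W +>\<^bsub>M\<^esub> (c \<odot>\<^bsub>M\<^esub> x))\<rparr>"

text \<open>
  The family of the elements \<open>v i\<close>, for \<open>i \<in> I\<close>, is a basis of \<open>M\<close>. (The constant
  \<^const>\<open>vectorspace.basis\<close> is specified only when \<open>M\<close> is a vector space.)
\<close>

definition is_basis :: "('f::field, 'v) module \<Rightarrow> 'i set \<Rightarrow> ('i \<Rightarrow> 'v) \<Rightarrow> bool" where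
  "is_basis M I v \<longleftrightarrow>
    vectorspace class_ring M \<and> inj_on v I \<and> vectorspace.basis class_ring M (v ` I)"

definition bilinear_form ::
  "('f::field, 'v) module \<Rightarrow> ('f, 'w) module \<Rightarrow> ('v \<Rightarrow> 'w \<Rightarrow> 'f) \<Rightarrow> bool" where
  "bilinear_form M N B \<longleftrightarrow>
    (\<forall>v\<in>carrier M. \<forall>v'\<in>carrier M. \<forall>w\<in>carrier N. B (v \<oplus>\<^bsub>M\<^esub> v') w = B v w + B v' w) \<and>
    (\<forall>a. \<forall>v\<in>carrier M. \<forall>w\<in>carrier N. B (a \<odot>\<^bsub>M\<^esub> v) w = a * B v w) \<and>
    (\<forall>v\<in>carrier M. \<forall>w\<in>carrier N. \<forall>w'\<in>carrier N. B v (w \<oplus>\<^bsub>N\<^esub> w') = B v w + B v w') \<and>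
    (\<forall>a. \<forall>v\<in>carrier M. \<forall>w\<in>carrier N. B v (a \<odot>\<^bsub>N\<^esub> w) = a * B v w)"

definition nondegenerate_form ::
  "('f::field, 'v) module \<Rightarrow> ('f, 'w) module \<Rightarrow> ('v \<Rightarrow> 'w \<Rightarrow> 'f) \<Rightarrow> bool" where
  "nondegenerate_form M N B \<longleftrightarrow>
    (\<forall>v\<in>carrier M. (\<forall>w\<in>carrier N. B v w = 0) \<longrightarrow> v = \<zero>\<^bsub>M\<^esub>) \<and>
    (\<forall>w\<in>carrier N. (\<forall>v\<in>carrier M. B v w = 0) \<longrightarrow> w = \<zero>\<^bsub>N\<^esub>)"

definition regular_seqs :: "'a pair_pre_digraph \<Rightarrow> nat \<Rightarrow> 'a list set" where
  "regular_seqs G n = {xs. length xs = n + 1 \<and> set xs \<subseteq> pverts G \<and> distinct_adj xs}"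

definition regular_symbol :: "'a list \<Rightarrow> 'a list \<Rightarrow>\<^sub>0 'f::field" where
  "regular_symbol xs = (if distinct_adj xs then basis_elem xs else 0)"

text \<open>
  The complex starts in degree \<open>0\<close>: the differential vanishes on symbols with a single index
  (there is no augmentation), and the space of paths in degree \<open>-1\<close> is zero.
\<close>

definition differential :: "('a list \<Rightarrow>\<^sub>0 'f::field) \<Rightarrow> ('a list \<Rightarrow>\<^sub>0 'f)" where
  "differential f = (\<Sum>xs\<in>Poly_Mapping.keys f.
     if length xs \<le> 1 then 0
     else scale (Poly_Mapping.lookup f xs)
       (\<Sum>i<length xs. scale ((-1) ^ i) (regular_symbol (take i xs @ drop (Suc i) xs))))"

definition R_chains :: "'a pair_pre_digraph \<Rightarrow> nat \<Rightarrow> ('a list \<Rightarrow>\<^sub>0 'f::field) set" where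
  "R_chains G n = supported_on (regular_seqs G n)"

definition A_chains :: "'a pair_pre_digraph \<Rightarrow> nat \<Rightarrow> ('a list \<Rightarrow>\<^sub>0 'f::field) set" where
  "A_chains G n = supported_on (n_paths G n)"

definition Omega_set :: "'a pair_pre_digraph \<Rightarrow> nat \<Rightarrow> ('a list \<Rightarrow>\<^sub>0 'f::field) set" where
  "Omega_set G n = A_chains G n \<inter>
     {f \<in> R_chains G n. differential f \<in> (case n of 0 \<Rightarrow> {0} | Suc m \<Rightarrow> A_chains G m)}"

definition Omega :: "'a pair_pre_digraph \<Rightarrow> nat \<Rightarrow> ('f::field, 'a list \<Rightarrow>\<^sub>0 'f) module" where
  "Omega G n = subspace_of (Omega_set G n)"

definition concat_paths :: "'a list \<Rightarrow> 'a list \<Rightarrow> 'a list \<Rightarrow>\<^sub>0 'f::field" where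
  "concat_paths p q = (if last p = hd q then basis_elem (p @ tl q) else 0)"

definition path_mult ::
  "('a list \<Rightarrow>\<^sub>0 'f::field) \<Rightarrow> ('a list \<Rightarrow>\<^sub>0 'f) \<Rightarrow> ('a list \<Rightarrow>\<^sub>0 'f)" where
  "path_mult f g = (\<Sum>p\<in>Poly_Mapping.keys f. \<Sum>q\<in>Poly_Mapping.keys g.
     scale (Poly_Mapping.lookup f p * Poly_Mapping.lookup g q) (concat_paths p q))"

definition path_algebra :: "'a pair_pre_digraph \<Rightarrow> ('a list \<Rightarrow>\<^sub>0 'f::field) ring" where
  "path_algebra G =
    \<lparr>carrier = supported_on (\<Union>n. n_paths G n), mult = path_mult,
     one = (\<Sum>v\<in>pverts G. basis_elem [v]), zero = 0, add = (+)\<rparr>"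

definition t_elem :: "'a pair_pre_digraph \<Rightarrow> 'a \<Rightarrow> 'a \<Rightarrow> 'a list \<Rightarrow>\<^sub>0 'f::field" where
  "t_elem G x y = (\<Sum>p\<in>two_paths G x y. basis_elem p)"

definition T_ideal :: "'a pair_pre_digraph \<Rightarrow> ('a list \<Rightarrow>\<^sub>0 'f::field) set" where
  "T_ideal G = Idl\<^bsub>path_algebra G\<^esub> {t_elem G x y | x y. dist_two G x y}"

definition path_degree :: "'a pair_pre_digraph \<Rightarrow> nat \<Rightarrow> ('a list \<Rightarrow>\<^sub>0 'f::field) set" where
  "path_degree G n = supported_on (n_paths G n)"

definition T_degree :: "'a pair_pre_digraph \<Rightarrow> nat \<Rightarrow> ('a list \<Rightarrow>\<^sub>0 'f::field) set" where
  "T_degree G n = T_ideal G \<inter> path_degree G n"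

definition Omega_cochains ::
  "'a pair_pre_digraph \<Rightarrow> nat \<Rightarrow> ('f::field, ('a list \<Rightarrow>\<^sub>0 'f) set) module" where
  "Omega_cochains G n = quotient_space (subspace_of (path_degree G n)) (T_degree G n)"

definition path_coset ::
  "'a pair_pre_digraph \<Rightarrow> nat \<Rightarrow> 'a list \<Rightarrow> ('a list \<Rightarrow>\<^sub>0 'f::field) set" where
  "path_coset G n q = T_degree G n +>\<^bsub>subspace_of (path_degree G n)\<^esub> basis_elem q"

text \<open>
  The value on a coset is the common value of the standard form
  \<open>\<Sum>p. \<alpha>\<^sub>p * \<beta>\<^sub>p\<close> over all representatives of the coset. It exists for arguments in
  \<^const>\<open>Omega\<close> and \<^const>\<open>Omega_cochains\<close>.
\<close>

definition pairing :: "('a list \<Rightarrow>\<^sub>0 'f::field) \<Rightarrow> ('a list \<Rightarrow>\<^sub>0 'f) set \<Rightarrow> 'f" where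
  "pairing w X = (THE a. \<forall>f\<in>X.
     a = (\<Sum>p\<in>Poly_Mapping.keys w. Poly_Mapping.lookup w p * Poly_Mapping.lookup f p))"

definition s_elem :: "'a list set \<Rightarrow> 'a list set \<Rightarrow> 'a list \<Rightarrow>\<^sub>0 'f::field" where
  "s_elem A B = (\<Sum>p\<in>A. basis_elem p) - (\<Sum>p\<in>B. basis_elem p)"

definition s'_elem :: "'a list set \<Rightarrow> 'a list \<Rightarrow>\<^sub>0 'f::field" where
  "s'_elem c = (\<Sum>p\<in>c. basis_elem p)"

end

theory Submission
  imports Defs
begin

text \<open>
  A chain of \<open>n\<close>-paths lies in \<^const>\<open>Omega_set\<close> if and only if its coefficient function sums
  to \<open>0\<close> over the \<open>2\<close>-paths \<open>x, v, y\<close> inserted between any \<open>a\<close> and \<open>b\<close>, for every \<open>x, y\<close> at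
  distance two: such a sum is, up to sign, the coefficient of the differential at the non-path
  \<open>a, x, y, b\<close>. The functions with this property annihilate the whole ideal of relations, since
  the property is stable under translation by paths on either side. Without multisquares every relation
  reads \<open>e\<^sub>p\<close> for a thin path \<open>p\<close> or \<open>e\<^sub>p + e\<^sub>q\<close> for a short move. Hence, modulo the relations, all
  paths of a class agree up to sign, and they vanish if the class is thin, or if the characteristic
  is not \<open>2\<close> and the signs cannot be chosen consistently, that is, the class is not bipartite. On
  the remaining classes the signed sums pair with representatives to \<open>\<plusminus>1\<close> or \<open>0\<close>; two families
  in duality, each of which separates the other space, are bases.
\<close>

section \<open>Linear algebra of module records\<close>

lemma lookup_scale [simp]:
  "Poly_Mapping.lookup (scale c f) k = c * Poly_Mapping.lookup f k"
  by (simp add: scale_def Poly_Mapping.map.rep_eq when_def)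

lemma scale_add_right: "scale c (f + g) = scale c f + scale c g"
  and scale_add_left: "scale (c + d) f = scale c f + scale d f"
  and scale_scale [simp]: "scale c (scale d f) = scale (c * d) f"
  and scale_one [simp]: "scale 1 f = f"
  and scale_zero_left [simp]: "scale 0 f = 0"
  and scale_zero_right [simp]: "scale c 0 = 0"
  and scale_minus_one [simp]: "scale (-1) f = - f"
  by (intro poly_mapping_eqI; simp add: lookup_add algebra_simps)+

lemma scale_single [simp]:
  "scale c (Poly_Mapping.single p a) = Poly_Mapping.single p (c * a)"
  by (intro poly_mapping_eqI) (simp add: lookup_single when_def)

lemma scale_sum: "scale c (sum f A) = (\<Sum>x\<in>A. scale c (f x))"
  by (induction A rule: infinite_finite_induct) (auto simp: scale_add_right)

lemma keys_scale_subset: "Poly_Mapping.keys (scale c f) \<subseteq> Poly_Mapping.keys f"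
  by (auto simp: in_keys_iff)

lemma lookup_sum_basis_elem:
  "finite A \<Longrightarrow> Poly_Mapping.lookup (\<Sum>p\<in>A. basis_elem p) q = of_bool (q \<in> A)"
  by (simp add: lookup_sum lookup_single when_def)

definition linear_subspace :: "('b \<Rightarrow>\<^sub>0 'f::field) set \<Rightarrow> bool" where
  "linear_subspace W \<longleftrightarrow>
    0 \<in> W \<and> (\<forall>f\<in>W. \<forall>g\<in>W. f + g \<in> W) \<and> (\<forall>c. \<forall>f\<in>W. scale c f \<in> W)"

lemma
  assumes "linear_subspace W"
  shows linear_subspace_zero: "0 \<in> W"
    and linear_subspace_add: "f \<in> W \<Longrightarrow> g \<in> W \<Longrightarrow> f + g \<in> W"
    and linear_subspace_scale: "f \<in> W \<Longrightarrow> scale c f \<in> W"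
    and linear_subspace_uminus: "f \<in> W \<Longrightarrow> - f \<in> W"
    and linear_subspace_diff: "f \<in> W \<Longrightarrow> g \<in> W \<Longrightarrow> f - g \<in> W"
proof -
  show 1: "0 \<in> W" "\<And>f g. f \<in> W \<Longrightarrow> g \<in> W \<Longrightarrow> f + g \<in> W" "\<And>c f. f \<in> W \<Longrightarrow> scale c f \<in> W"
    using assms by (auto simp: linear_subspace_def)
  show 2: "- f \<in> W" if "f \<in> W" for f
    using 1(3)[OF that, of "-1"] by simp
  show "f - g \<in> W" if "f \<in> W" "g \<in> W" for f g
    using 1(2)[OF that(1) 2[OF that(2)]] by simp
qed

lemma linear_subspace_sum:
  assumes "linear_subspace W" "\<And>x. x \<in> A \<Longrightarrow> f x \<in> W"
  shows "sum f A \<in> W"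
  using assms(2)
  by (induction A rule: infinite_finite_induct)
     (auto simp: linear_subspace_zero[OF assms(1)] linear_subspace_add[OF assms(1)])

lemma linear_subspace_supported_on: "linear_subspace (supported_on S)"
  unfolding linear_subspace_def supported_on_def
  by (intro conjI ballI allI CollectI)
     (auto dest!: subsetD[OF Poly_Mapping.keys_add] subsetD[OF keys_scale_subset])

lemma subspace_of_simps [simp]:
  "carrier (subspace_of W) = W"
  "zero (subspace_of W) = 0"
  "add (subspace_of W) = (+)"
  "smult (subspace_of W) = scale"
  by (simp_all add: subspace_of_def)

lemma vectorspace_subspace_of:
  fixes W :: "('b \<Rightarrow>\<^sub>0 'f::field) set"
  assumes W: "linear_subspace W"
  shows "vectorspace class_ring (subspace_of W)"
proof -
  have "abelian_group (subspace_of W)"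
    by (rule abelian_groupI)
       (use linear_subspace_uminus[OF W] in
        \<open>auto simp: linear_subspace_zero[OF W] linear_subspace_add[OF W] algebra_simps
              intro!: bexI[of _ "- x" for x]\<close>)
  then have "module class_ring (subspace_of W)"
    by (intro moduleI class_cring.cring_axioms)
       (auto simp: linear_subspace_scale[OF W] scale_add_left scale_add_right)
  then show ?thesis
    by (simp add: vectorspace_def class_field.field_axioms)
qed

lemma coset_subspace_of: "W +>\<^bsub>subspace_of V\<^esub> x = (\<lambda>h. h + x) ` W"
  by (auto simp: a_r_coset_def r_coset_def)

lemma coset_eq_iff:
  assumes W: "linear_subspace W"
  shows "W +>\<^bsub>subspace_of V\<^esub> x = W +>\<^bsub>subspace_of V\<^esub> y \<longleftrightarrow> x - y \<in> W"
proof
  assume "W +>\<^bsub>subspace_of V\<^esub> x = W +>\<^bsub>subspace_of V\<^esub> y"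
  then have "x \<in> (\<lambda>h. h + y) ` W"
    unfolding coset_subspace_of using linear_subspace_zero[OF W] by force
  then show "x - y \<in> W" by auto
next
  assume xy: "x - y \<in> W"
  have "(\<lambda>h. h + x) ` W \<subseteq> (\<lambda>h. h + y) ` W" if "x - y \<in> W" for x y
  proof
    fix u assume "u \<in> (\<lambda>h. h + x) ` W"
    then obtain h where "h \<in> W" "u = h + x" by auto
    then show "u \<in> (\<lambda>h. h + y) ` W"
      by (intro image_eqI[of _ _ "h + (x - y)"]) (auto intro: linear_subspace_add[OF W] that)
  qed
  from this[OF xy] this[of y x] linear_subspace_uminus[OF W xy]
  show "W +>\<^bsub>subspace_of V\<^esub> x = W +>\<^bsub>subspace_of V\<^esub> y"
    unfolding coset_subspace_of by auto
qed

lemma quotient_carrier: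
  "carrier (quotient_space (subspace_of V) W) = (\<lambda>x. W +>\<^bsub>subspace_of V\<^esub> x) ` V"
  by (auto simp: quotient_space_def A_RCOSETS_def' a_r_coset_def')

lemma quotient_zero:
  "zero (quotient_space (subspace_of V) W) = W +>\<^bsub>subspace_of V\<^esub> 0"
  by (simp add: quotient_space_def coset_subspace_of)

lemma quotient_add:
  assumes W: "linear_subspace W"
  shows "add (quotient_space (subspace_of V) W) (W +>\<^bsub>subspace_of V\<^esub> x) (W +>\<^bsub>subspace_of V\<^esub> y)
    = W +>\<^bsub>subspace_of V\<^esub> (x + y)"
proof -
  have "h + x + (k + y) \<in> (\<lambda>h. h + (x + y)) ` W" if "h \<in> W" "k \<in> W" for h k
    by (rule image_eqI[of _ _ "h + k"]) (simp_all add: linear_subspace_add[OF W] that)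
  moreover have "\<exists>k\<in>W. \<exists>l\<in>W. h + (x + y) = k + x + (l + y)" if "h \<in> W" for h
    using that linear_subspace_zero[OF W]
    by (intro bexI[of _ h] bexI[of _ 0]) simp_all
  ultimately show ?thesis
    by (auto simp: quotient_space_def coset_subspace_of set_add_def' image_iff)
qed

lemma quotient_smult:
  assumes W: "linear_subspace W"
  shows "smult (quotient_space (subspace_of V) W) c (W +>\<^bsub>subspace_of V\<^esub> x)
    = W +>\<^bsub>subspace_of V\<^esub> (scale c x)"
proof -
  have const: "W +>\<^bsub>subspace_of V\<^esub> (scale c u) = W +>\<^bsub>subspace_of V\<^esub> (scale c x)"
    if "u \<in> W +>\<^bsub>subspace_of V\<^esub> x" for u
    using that
    by (subst coset_eq_iff[OF W])
       (auto simp: coset_subspace_of scale_add_right intro: linear_subspace_scale[OF W])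
  have "x \<in> W +>\<^bsub>subspace_of V\<^esub> x"
    using linear_subspace_zero[OF W] by (force simp: coset_subspace_of)
  then have "(\<Union>u\<in>W +>\<^bsub>subspace_of V\<^esub> x. W +>\<^bsub>subspace_of V\<^esub> (scale c u))
      = W +>\<^bsub>subspace_of V\<^esub> (scale c x)"
    by (intro SUP_eq_const const) blast
  then show ?thesis
    by (simp add: quotient_space_def)
qed

lemma vectorspace_quotient_space:
  fixes V W :: "('b \<Rightarrow>\<^sub>0 'f::field) set"
  assumes V: "linear_subspace V" and W: "linear_subspace W"
  shows "vectorspace class_ring (quotient_space (subspace_of V) W)"
proof -
  let ?N = "quotient_space (subspace_of V) W"
  note simps = quotient_carrier quotient_zero quotient_add[OF W] quotient_smult[OF W]
  have "abelian_group ?N"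
  proof (rule abelian_groupI)
    fix x assume "x \<in> carrier ?N"
    then obtain f where f: "f \<in> V" "x = W +>\<^bsub>subspace_of V\<^esub> f"
      by (auto simp: simps)
    show "\<exists>y\<in>carrier ?N. y \<oplus>\<^bsub>?N\<^esub> x = \<zero>\<^bsub>?N\<^esub>"
      by (rule bexI[of _ "W +>\<^bsub>subspace_of V\<^esub> (- f)"])
         (auto simp: f simps linear_subspace_uminus[OF V])
  qed (auto simp: simps linear_subspace_zero[OF V] linear_subspace_add[OF V] algebra_simps)
  then have "module class_ring ?N"
    by (intro moduleI class_cring.cring_axioms)
       (auto simp: simps linear_subspace_scale[OF V] scale_add_left scale_add_right)
  then show ?thesis
    by (simp add: vectorspace_def class_field.field_axioms)
qed

lemma is_basis_by_dual_family:
  fixes M :: "('f::field, 'v) module" and \<phi> :: "'i \<Rightarrow> 'v \<Rightarrow> 'f"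
  assumes V: "vectorspace class_ring M" and I: "finite I"
    and v: "\<And>i. i \<in> I \<Longrightarrow> v i \<in> carrier M"
    and add: "\<And>i x y. i \<in> I \<Longrightarrow> x \<in> carrier M \<Longrightarrow> y \<in> carrier M \<Longrightarrow>
      \<phi> i (x \<oplus>\<^bsub>M\<^esub> y) = \<phi> i x + \<phi> i y"
    and smult: "\<And>i a x. i \<in> I \<Longrightarrow> x \<in> carrier M \<Longrightarrow> \<phi> i (a \<odot>\<^bsub>M\<^esub> x) = a * \<phi> i x"
    and dual: "\<And>i j. i \<in> I \<Longrightarrow> j \<in> I \<Longrightarrow> \<phi> i (v j) = of_bool (i = j)"
    and separating: "\<And>x. x \<in> carrier M \<Longrightarrow> (\<And>i. i \<in> I \<Longrightarrow> \<phi> i x = 0) \<Longrightarrow> x = \<zero>\<^bsub>M\<^esub>"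
  shows "is_basis M I v"
proof -
  interpret V: vectorspace class_ring M by (rule V)
  have zero: "\<phi> i \<zero>\<^bsub>M\<^esub> = 0" if "i \<in> I" for i
    using add[OF that V.M.zero_closed V.M.zero_closed] V.M.l_zero[OF V.M.zero_closed]
    by (metis add_cancel_right_left)
  have inj: "inj_on v I"
    by (rule inj_onI) (metis dual of_bool_eq_iff)
  have finsum: "\<phi> i (finsum M f S) = (\<Sum>x\<in>S. \<phi> i (f x))"
    if "finite S" "i \<in> I" "f \<in> S \<rightarrow> carrier M" for i S and f :: "'v \<Rightarrow> 'v"
    using that by (induction S) (auto simp: zero add Pi_def)
  have lincomb: "\<phi> i (V.lincomb a (v ` I)) = a (v i)" if "i \<in> I" for i a
  proof -
    have "\<phi> i (V.lincomb a (v ` I)) = (\<Sum>x\<in>v ` I. \<phi> i (a x \<odot>\<^bsub>M\<^esub> x))"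
      unfolding V.lincomb_def by (intro finsum) (use I v that in auto)
    also have "\<dots> = (\<Sum>j\<in>I. a (v j) * of_bool (i = j))"
      by (subst sum.reindex[OF inj]) (auto intro!: sum.cong simp: smult v dual that)
    finally show ?thesis using I that by simp
  qed
  have sub: "v ` I \<subseteq> carrier M" using v by auto
  have indpt: "V.lin_indpt (v ` I)"
    by (rule V.finite_lin_indpt2) (use I v in \<open>auto simp: lincomb[symmetric] zero\<close>)
  have gen: "V.span (v ` I) = carrier M"
  proof
    show "V.span (v ` I) \<subseteq> carrier M" using sub by (rule V.span_is_subset2)
    show "carrier M \<subseteq> V.span (v ` I)"
    proof
      fix x assume x: "x \<in> carrier M"
      define a where "a = (\<lambda>u. \<phi> (the_inv_into I v u) x)"
      define y where "y = V.lincomb a (v ` I)"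
      have y: "y \<in> carrier M"
        unfolding y_def by (rule V.lincomb_closed) (use I sub in auto)
      have "\<phi> i (x \<ominus>\<^bsub>M\<^esub> y) = 0" if i: "i \<in> I" for i
      proof -
        have "\<phi> i (y \<oplus>\<^bsub>M\<^esub> (\<ominus>\<^bsub>M\<^esub> y)) = 0"
          using y zero[OF i] by (simp add: V.M.r_neg)
        then have "\<phi> i (\<ominus>\<^bsub>M\<^esub> y) = - \<phi> i y"
          using add[OF i y V.M.a_inv_closed[OF y]] by (simp add: eq_neg_iff_add_eq_0 add.commute)
        then show ?thesis
          using lincomb[OF i, of a] i x y inj add[OF i x V.M.a_inv_closed[OF y]]
          by (simp add: a_minus_def y_def a_def the_inv_into_f_f)
      qed
      then have "x \<ominus>\<^bsub>M\<^esub> y = \<zero>\<^bsub>M\<^esub>"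
        using x y by (intro separating) auto
      then have "x = y"
        using x y V.M.minus_equality[of x "\<ominus>\<^bsub>M\<^esub> y"] by (simp add: a_minus_def)
      then show "x \<in> V.span (v ` I)"
        unfolding y_def V.finite_span[OF finite_imageI[OF I] sub] by auto
    qed
  qed
  show ?thesis
    unfolding is_basis_def V.basis_def using V inj indpt gen sub by simp
qed

section \<open>Linear functionals given by their values on the basis\<close>

lemma poly_mapping_sum_singles:
  "f = (\<Sum>p\<in>Poly_Mapping.keys f. Poly_Mapping.single p (Poly_Mapping.lookup f p))"
  by (intro poly_mapping_eqI) (auto simp: lookup_sum lookup_single when_def in_keys_iff)

lemma supported_on_induct [consumes 1, case_names zero single add]:
  assumes "f \<in> supported_on S"
    and "P 0"
    and "\<And>p c. p \<in> S \<Longrightarrow> P (Poly_Mapping.single p c)"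
    and "\<And>f g. P f \<Longrightarrow> P g \<Longrightarrow> P (f + g)"
  shows "P f"
proof -
  have "P (\<Sum>p\<in>K. Poly_Mapping.single p (Poly_Mapping.lookup f p))" if "finite K" "K \<subseteq> S" for K
    using that by (induction K) (auto intro: assms(2-4))
  from this[of "Poly_Mapping.keys f"] assms(1) show ?thesis
    by (simp add: supported_on_def poly_mapping_sum_singles[symmetric])
qed

definition eval_on :: "('b \<Rightarrow> 'f) \<Rightarrow> ('b \<Rightarrow>\<^sub>0 'f::field) \<Rightarrow> 'f" where
  "eval_on w f = (\<Sum>p\<in>Poly_Mapping.keys f. w p * Poly_Mapping.lookup f p)"

lemma eval_on_superset:
  assumes "finite K" "Poly_Mapping.keys f \<subseteq> K"
  shows "eval_on w f = (\<Sum>p\<in>K. w p * Poly_Mapping.lookup f p)"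
  unfolding eval_on_def using assms
  by (intro sum.mono_neutral_left) (auto simp: in_keys_iff)

lemma eval_on_zero [simp]: "eval_on w 0 = 0"
  by (simp add: eval_on_def)

lemma eval_on_single [simp]: "eval_on w (Poly_Mapping.single p c) = w p * c"
  by (subst eval_on_superset[of "{p}"]) auto

lemma eval_on_add: "eval_on w (f + g) = eval_on w f + eval_on w g"
proof -
  let ?K = "Poly_Mapping.keys f \<union> Poly_Mapping.keys g"
  have "Poly_Mapping.keys (f + g) \<subseteq> ?K" by (rule Poly_Mapping.keys_add)
  then show ?thesis
    by (simp add: eval_on_superset[of ?K] lookup_add sum.distrib algebra_simps)
qed

lemma eval_on_scale: "eval_on w (scale c f) = c * eval_on w f"
  using keys_scale_subset[of c f]
  by (simp add: eval_on_superset[of "Poly_Mapping.keys f"] sum_distrib_left algebra_simps)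

lemma eval_on_sum: "eval_on w (sum f A) = (\<Sum>x\<in>A. eval_on w (f x))"
  by (induction A rule: infinite_finite_induct) (auto simp: eval_on_add)

lemma eval_on_uminus: "eval_on w (- f) = - eval_on w f"
  using eval_on_scale[of w "-1" f] by simp

lemma eval_on_diff: "eval_on w (f - g) = eval_on w f - eval_on w g"
  using eval_on_add[of w f "- g"] by (simp add: eval_on_uminus)

lemma eval_on_lookup_commute:
  "eval_on (Poly_Mapping.lookup f) g = eval_on (Poly_Mapping.lookup g) f"
proof -
  let ?K = "Poly_Mapping.keys f \<union> Poly_Mapping.keys g"
  show ?thesis
    by (simp add: eval_on_superset[of ?K] mult.commute)
qed

section \<open>Paths and middle vertices\<close>

definition dipath :: "'a pair_pre_digraph \<Rightarrow> 'a list \<Rightarrow> bool" where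
  "dipath G p \<longleftrightarrow>
    p \<noteq> [] \<and> set p \<subseteq> pverts G \<and> successively (\<lambda>x y. (x, y) \<in> parcs G) p"

definition middles :: "'a pair_pre_digraph \<Rightarrow> 'a \<Rightarrow> 'a \<Rightarrow> 'a set" where
  "middles G x y = {v. (x, v) \<in> parcs G \<and> (v, y) \<in> parcs G}"

lemma successively_iff_nth:
  "successively P p \<longleftrightarrow> (\<forall>i<length p - 1. P (p ! i) (p ! Suc i))"
  by (induction P p rule: successively.induct) (auto simp: All_less_Suc2)

lemma n_paths_eq: "n_paths G n = {p. dipath G p \<and> length p = Suc n}"
  by (auto simp: n_paths_def dipath_def successively_iff_nth)

lemma UN_n_paths: "(\<Union>n. n_paths G n) = {p. dipath G p}"
proof -
  have "\<exists>n. length p = Suc n" if "dipath G p" for p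
    using that by (cases p) (auto simp: dipath_def)
  then show ?thesis by (auto simp: n_paths_eq)
qed

lemma dipath_join:
  assumes "dipath G p" "dipath G q" "last p = hd q"
  shows "dipath G (p @ tl q)"
  using assms by (cases q) (auto simp: dipath_def successively_append_iff successively_Cons)

context pair_digraph
begin

lemma dipath_middle_iff:
  "dipath G (a @ x # v # y # b) \<longleftrightarrow>
    dipath G (a @ [x]) \<and> dipath G (y # b) \<and> v \<in> middles G x y"
  by (auto simp: dipath_def middles_def successively_append_iff successively_Cons
      dest: in_arcsD1 in_arcsD2)

lemma finite_middles: "finite (middles G x y)"
  by (rule finite_subset[OF _ pair_finite_verts]) (auto simp: middles_def dest: in_arcsD1)

lemma finite_n_paths: "finite (n_paths G n)"
  by (rule finite_subset[OF _ finite_lists_length_eq[OF pair_finite_verts, of "Suc n"]])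
     (auto simp: n_paths_def)

lemma two_paths_eq: "two_paths G x y = (\<lambda>v. [x, v, y]) ` middles G x y"
proof -
  have "\<exists>v. p = [x, v, y] \<and> v \<in> middles G x y" if "p \<in> two_paths G x y" for p
  proof -
    from that have "length p = Suc (Suc (Suc 0))"
      by (auto simp: two_paths_def n_paths_def)
    then obtain x' v y' where "p = [x', v, y']"
      by (auto simp: length_Suc_conv)
    then show ?thesis
      using that by (auto simp: two_paths_def n_paths_eq dipath_def middles_def)
  qed
  then show ?thesis
    by (auto simp: two_paths_def n_paths_eq dipath_def middles_def dest: in_arcsD1 in_arcsD2)
qed

lemma card_two_paths: "card (two_paths G x y) = card (middles G x y)"
  unfolding two_paths_eq by (rule card_image) (auto simp: inj_on_def)

lemma dist_two_iff:
  "dist_two G x y \<longleftrightarrow> x \<noteq> y \<and> (x, y) \<notin> parcs G \<and> middles G x y \<noteq> {}"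
  by (simp add: dist_two_def two_paths_eq)

end

section \<open>The path algebra\<close>

lemma path_mult_superset:
  assumes "finite P" "Poly_Mapping.keys f \<subseteq> P" "finite Q" "Poly_Mapping.keys g \<subseteq> Q"
  shows "path_mult f g = (\<Sum>p\<in>P. \<Sum>q\<in>Q.
    scale (Poly_Mapping.lookup f p * Poly_Mapping.lookup g q) (concat_paths p q))"
proof -
  have "(\<Sum>q\<in>Poly_Mapping.keys g.
      scale (Poly_Mapping.lookup f p * Poly_Mapping.lookup g q) (concat_paths p q)) =
    (\<Sum>q\<in>Q. scale (Poly_Mapping.lookup f p * Poly_Mapping.lookup g q) (concat_paths p q))" for p
    using assms by (intro sum.mono_neutral_left) (auto simp: in_keys_iff)
  then show ?thesis
    unfolding path_mult_def using assms
    by (intro sum.mono_neutral_cong_left) (auto simp: in_keys_iff)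
qed

lemma path_mult_zero_left [simp]: "path_mult 0 g = 0"
  and path_mult_zero_right [simp]: "path_mult f 0 = 0"
  by (simp_all add: path_mult_def)

lemma path_mult_single [simp]:
  "path_mult (Poly_Mapping.single p a) (Poly_Mapping.single q b) =
    scale (a * b) (concat_paths p q)"
  by (subst path_mult_superset[of "{p}" _ "{q}"]) auto

lemma path_mult_add_left: "path_mult (f + f') g = path_mult f g + path_mult f' g"
proof -
  let ?P = "Poly_Mapping.keys f \<union> Poly_Mapping.keys f'"
  have "Poly_Mapping.keys (f + f') \<subseteq> ?P" by (rule Poly_Mapping.keys_add)
  then show ?thesis
    by (simp add: path_mult_superset[of ?P _ "Poly_Mapping.keys g"] lookup_add
        distrib_right scale_add_left sum.distrib)
qed

lemma path_mult_add_right: "path_mult f (g + g') = path_mult f g + path_mult f g'"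
proof -
  let ?Q = "Poly_Mapping.keys g \<union> Poly_Mapping.keys g'"
  have "Poly_Mapping.keys (g + g') \<subseteq> ?Q" by (rule Poly_Mapping.keys_add)
  then show ?thesis
    by (simp add: path_mult_superset[of "Poly_Mapping.keys f" _ ?Q] lookup_add
        distrib_left scale_add_left sum.distrib)
qed

lemma path_mult_sum_left: "path_mult (sum f A) g = (\<Sum>x\<in>A. path_mult (f x) g)"
  by (induction A rule: infinite_finite_induct) (auto simp: path_mult_add_left)

lemma path_mult_sum_right: "path_mult g (sum f A) = (\<Sum>x\<in>A. path_mult g (f x))"
  by (induction A rule: infinite_finite_induct) (auto simp: path_mult_add_right)

lemma path_mult_scale_left: "path_mult (scale c f) g = scale c (path_mult f g)"
  using keys_scale_subset[of c f]
  by (simp add: path_mult_superset[of "Poly_Mapping.keys f" _ "Poly_Mapping.keys g"]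
      scale_sum mult.assoc)

lemma path_mult_closed:
  assumes "f \<in> supported_on {p. dipath G p}" "g \<in> supported_on {p. dipath G p}"
  shows "path_mult f g \<in> supported_on {p. dipath G p}"
  unfolding path_mult_def
proof (intro linear_subspace_sum linear_subspace_scale linear_subspace_supported_on)
  fix p q assume "p \<in> Poly_Mapping.keys f" "q \<in> Poly_Mapping.keys g"
  then have "dipath G p" "dipath G q" using assms by (auto simp: supported_on_def)
  then show "concat_paths p q \<in> (supported_on {p. dipath G p} :: ('a list \<Rightarrow>\<^sub>0 'b) set)"
    by (auto simp: concat_paths_def supported_on_def dipath_join)
qed

lemma path_mult_assoc:
  assumes "f \<in> supported_on {p. dipath G p}" "g \<in> supported_on {p. dipath G p}"
    "h \<in> supported_on {p. dipath G p}"
  shows "path_mult (path_mult f g) h = path_mult f (path_mult g h)"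
  using assms(1)
proof (induction rule: supported_on_induct)
  case (single p a)
  from assms(2) show ?case
  proof (induction rule: supported_on_induct)
    case (single q b)
    from assms(3) show ?case
    proof (induction rule: supported_on_induct)
      case (single r c)
      from \<open>q \<in> _\<close> have "last (p @ tl q) = last q" if "last p = hd q"
        using that by (cases q) (auto simp: dipath_def)
      moreover from \<open>q \<in> _\<close> have "hd (q @ tl r) = hd q" "tl (q @ tl r) = tl q @ tl r"
        by (auto simp: dipath_def)
      ultimately show ?case
        by (auto simp: concat_paths_def mult.assoc)
    qed (auto simp: path_mult_add_right)
  qed (auto simp: path_mult_add_left path_mult_add_right)
qed (auto simp: path_mult_add_left)

lemma path_algebra_simps [simp]:
  "carrier (path_algebra G) = supported_on {p. dipath G p}"
  "mult (path_algebra G) = path_mult"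
  "one (path_algebra G) = (\<Sum>v\<in>pverts G. basis_elem [v])"
  "zero (path_algebra G) = 0"
  "add (path_algebra G) = (+)"
  by (simp_all add: path_algebra_def UN_n_paths)

context pair_digraph
begin

lemma path_mult_one_left:
  assumes "f \<in> supported_on {p. dipath G p}"
  shows "path_mult (\<Sum>v\<in>pverts G. basis_elem [v]) f = f"
  using assms
proof (induction rule: supported_on_induct)
  case (single p c)
  then have p: "p \<noteq> []" "hd p \<in> pverts G" by (cases p; auto simp: dipath_def)+
  have "path_mult (\<Sum>v\<in>pverts G. basis_elem [v]) (Poly_Mapping.single p c) =
      (\<Sum>v\<in>pverts G. if hd p = v then Poly_Mapping.single p c else 0)"
    unfolding path_mult_sum_left
    by (rule sum.cong) (use p in \<open>auto simp: concat_paths_def\<close>)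
  then show ?case using p pair_finite_verts by simp
qed (auto simp: path_mult_add_right)

lemma path_mult_one_right:
  assumes "f \<in> supported_on {p. dipath G p}"
  shows "path_mult f (\<Sum>v\<in>pverts G. basis_elem [v]) = f"
  using assms
proof (induction rule: supported_on_induct)
  case (single p c)
  then have p: "p \<noteq> []" "last p \<in> pverts G" by (auto simp: dipath_def)
  have "path_mult (Poly_Mapping.single p c) (\<Sum>v\<in>pverts G. basis_elem [v]) =
      (\<Sum>v\<in>pverts G. if last p = v then Poly_Mapping.single p c else 0)"
    unfolding path_mult_sum_right
    by (rule sum.cong) (use p in \<open>auto simp: concat_paths_def\<close>)
  then show ?case using p pair_finite_verts by simp
qed (auto simp: path_mult_add_left)

lemma one_path_algebra_closed:
  "(\<Sum>v\<in>pverts G. basis_elem [v]) \<in> supported_on {p. dipath G p}"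
  by (intro linear_subspace_sum linear_subspace_supported_on)
     (auto simp: supported_on_def dipath_def)

lemma ring_path_algebra: "ring (path_algebra G :: ('a list \<Rightarrow>\<^sub>0 'f::field) ring)"
proof (rule ringI)
  note closed = linear_subspace_zero linear_subspace_add linear_subspace_uminus
  note closed = closed[OF linear_subspace_supported_on]
  show "abelian_group (path_algebra G :: ('a list \<Rightarrow>\<^sub>0 'f) ring)"
  proof (rule abelian_groupI)
    fix x :: "'a list \<Rightarrow>\<^sub>0 'f" assume "x \<in> carrier (path_algebra G)"
    then show "\<exists>y\<in>carrier (path_algebra G). y \<oplus>\<^bsub>path_algebra G\<^esub> x = \<zero>\<^bsub>path_algebra G\<^esub>"
      by (intro bexI[of _ "- x"]) (simp_all add: closed)
  qed (simp_all add: closed algebra_simps)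
  show "monoid (path_algebra G :: ('a list \<Rightarrow>\<^sub>0 'f) ring)"
    by (rule monoidI)
       (simp_all add: path_mult_closed path_mult_assoc path_mult_one_left path_mult_one_right
         one_path_algebra_closed)
qed (simp_all add: path_mult_add_left path_mult_add_right)

end

section \<open>The ideal of relations and its annihilator\<close>

definition annihilates_relations :: "'a pair_pre_digraph \<Rightarrow> ('a list \<Rightarrow> 'f::field) \<Rightarrow> bool" where
  "annihilates_relations G w \<longleftrightarrow>
    (\<forall>a x y b. dist_two G x y \<longrightarrow> (\<Sum>v\<in>middles G x y. w (a @ x # v # y # b)) = 0)"

lemma eval_on_path_mult_left:
  "eval_on w (path_mult (Poly_Mapping.single q c) g) =
    c * eval_on (\<lambda>p. if last q = hd p then w (q @ tl p) else 0) g"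
proof -
  have "g \<in> supported_on UNIV" by (simp add: supported_on_def)
  then show ?thesis
    by (induction rule: supported_on_induct)
       (auto simp: path_mult_add_right eval_on_add algebra_simps concat_paths_def)
qed

lemma eval_on_path_mult_right:
  "eval_on w (path_mult g (Poly_Mapping.single q c)) =
    c * eval_on (\<lambda>p. if last p = hd q then w (p @ tl q) else 0) g"
proof -
  have "g \<in> supported_on UNIV" by (simp add: supported_on_def)
  then show ?thesis
    by (induction rule: supported_on_induct)
       (auto simp: path_mult_add_left eval_on_add algebra_simps concat_paths_def)
qed

lemma annihilates_relations_left:
  assumes "annihilates_relations G w" "q \<noteq> []"
  shows "annihilates_relations G (\<lambda>p. if last q = hd p then w (q @ tl p) else 0)"
  unfolding annihilates_relations_def
proof (intro allI impI)
  fix a x y b assume xy: "dist_two G x y"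
  show "(\<Sum>v\<in>middles G x y. if last q = hd (a @ x # v # y # b)
    then w (q @ tl (a @ x # v # y # b)) else 0) = 0"
  proof (cases a)
    case Nil
    have "q = butlast q @ [last q]" using assms(2) by simp
    then have q: "q @ v # y # b = butlast q @ last q # v # y # b" for v
      by (metis append.assoc append_Cons append_Nil)
    have "(\<Sum>v\<in>middles G x y. w (butlast q @ x # v # y # b)) = 0"
      using assms(1) xy unfolding annihilates_relations_def by blast
    then show ?thesis by (cases "last q = x") (simp_all add: Nil q del: append_butlast_last_id)
  next
    case (Cons z a')
    then have "(\<Sum>v\<in>middles G x y. w ((q @ a') @ x # v # y # b)) = 0"
      using assms(1) xy unfolding annihilates_relations_def by blast
    then show ?thesis by (cases "last q = z") (simp_all add: Cons)
  qed
qed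

lemma annihilates_relations_right:
  assumes "annihilates_relations G w"
  shows "annihilates_relations G (\<lambda>p. if last p = hd q then w (p @ tl q) else 0)"
  unfolding annihilates_relations_def
proof (intro allI impI)
  fix a x y b assume xy: "dist_two G x y"
  then have "(\<Sum>v\<in>middles G x y. w (a @ x # v # y # (b @ tl q))) = 0"
    using assms unfolding annihilates_relations_def by blast
  moreover have last: "last (a @ x # v # y # b) = last (y # b)" for v
    by simp
  ultimately show "(\<Sum>v\<in>middles G x y. if last (a @ x # v # y # b) = hd q
    then w ((a @ x # v # y # b) @ tl q) else 0) = 0"
    unfolding last by (cases "last (y # b) = hd q") (simp_all del: last.simps)
qed

context pair_digraph
begin

lemma t_elem_eq: "t_elem G x y = (\<Sum>v\<in>middles G x y. basis_elem [x, v, y])"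
  unfolding t_elem_def two_paths_eq by (subst sum.reindex) (auto simp: inj_on_def)

lemma t_elem_closed: "t_elem G x y \<in> supported_on {p. dipath G p}"
  unfolding t_elem_eq
  by (intro linear_subspace_sum linear_subspace_supported_on)
     (auto simp: supported_on_def dipath_def middles_def dest: in_arcsD1 in_arcsD2)

lemma ideal_T_ideal: "ideal (T_ideal G :: ('a list \<Rightarrow>\<^sub>0 'f::field) set) (path_algebra G)"
  unfolding T_ideal_def
  by (rule ring.genideal_ideal[OF ring_path_algebra]) (auto simp: t_elem_closed)

lemma ideal_annihilator:
  "ideal {f \<in> supported_on {p. dipath G p}.
      \<forall>w. annihilates_relations G w \<longrightarrow> eval_on w f = (0::'f::field)} (path_algebra G)"
  (is "ideal ?J _")
proof (rule idealI[OF ring_path_algebra])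
  note closed = linear_subspace_zero linear_subspace_add linear_subspace_uminus
  note closed = closed[OF linear_subspace_supported_on]
  interpret R: ring "path_algebra G :: ('a list \<Rightarrow>\<^sub>0 'f) ring" by (rule ring_path_algebra)
  have inv: "\<ominus>\<^bsub>path_algebra G\<^esub> f = - f" if "f \<in> supported_on {p. dipath G p}"
    for f :: "'a list \<Rightarrow>\<^sub>0 'f"
    using that by (intro R.minus_equality) (simp_all add: closed)
  show "subgroup ?J (add_monoid (path_algebra G))"
  proof (rule subgroup.intro)
    fix f assume "f \<in> ?J"
    then show "inv\<^bsub>add_monoid (path_algebra G)\<^esub> f \<in> ?J"
      using inv[of f] by (simp add: a_inv_def closed eval_on_uminus)
  qed (auto simp: closed eval_on_add)
  fix f g :: "'a list \<Rightarrow>\<^sub>0 'f"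
  assume f: "f \<in> ?J" and g: "g \<in> carrier (path_algebra G)"
  from g have g': "g \<in> supported_on {p. dipath G p}" by simp
  have "eval_on w (path_mult g f) = 0" if "annihilates_relations G w" for w
    using g'
  proof (induction rule: supported_on_induct)
    case (single q c)
    with f annihilates_relations_left[OF that] show ?case
      by (simp add: eval_on_path_mult_left dipath_def)
  qed (auto simp: path_mult_add_left eval_on_add)
  with f g' show "g \<otimes>\<^bsub>path_algebra G\<^esub> f \<in> ?J" by (simp add: path_mult_closed)
  have "eval_on w (path_mult f g) = 0" if "annihilates_relations G w" for w
    using g'
  proof (induction rule: supported_on_induct)
    case (single q c)
    with f annihilates_relations_right[OF that] show ?case
      by (simp add: eval_on_path_mult_right)
  qed (auto simp: path_mult_add_right eval_on_add)
  with f g' show "f \<otimes>\<^bsub>path_algebra G\<^esub> g \<in> ?J" by (simp add: path_mult_closed)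
qed

lemma eval_on_T_ideal:
  assumes "annihilates_relations G w" "f \<in> T_ideal G"
  shows "eval_on w f = 0"
proof -
  let ?J = "{f \<in> supported_on {p. dipath G p}.
    \<forall>w. annihilates_relations G w \<longrightarrow> eval_on w f = (0::'b)}"
  have "t_elem G x y \<in> ?J" if xy: "dist_two G x y" for x y
  proof -
    have "eval_on w (t_elem G x y) = 0" if "annihilates_relations G w" for w :: "'a list \<Rightarrow> 'b"
    proof -
      from that xy have "(\<Sum>v\<in>middles G x y. w ([] @ x # v # y # [])) = 0"
        unfolding annihilates_relations_def by blast
      then show ?thesis by (simp add: t_elem_eq eval_on_sum)
    qed
    then show ?thesis by (simp add: t_elem_closed)
  qed
  then have "T_ideal G \<subseteq> ?J"
    unfolding T_ideal_def
    by (intro ring.genideal_minimal[OF ring_path_algebra] ideal_annihilator) auto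
  with assms show ?thesis by auto
qed

lemma linear_subspace_T_ideal: "linear_subspace (T_ideal G :: ('a list \<Rightarrow>\<^sub>0 'f::field) set)"
proof -
  interpret T: ideal "T_ideal G :: ('a list \<Rightarrow>\<^sub>0 'f) set" "path_algebra G" by (rule ideal_T_ideal)
  have "scale c f \<in> T_ideal G" if "f \<in> T_ideal G" for c and f :: "'a list \<Rightarrow>\<^sub>0 'f"
  proof -
    let ?u = "scale c (\<Sum>v\<in>pverts G. basis_elem [v]) :: 'a list \<Rightarrow>\<^sub>0 'f"
    have "path_mult ?u f \<in> T_ideal G"
      using T.I_l_closed[OF that, of ?u]
      by (simp add: linear_subspace_scale linear_subspace_supported_on one_path_algebra_closed)
    moreover have "f \<in> supported_on {p. dipath G p}" using T.a_subset that by auto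
    ultimately show ?thesis by (simp add: path_mult_scale_left path_mult_one_left)
  qed
  then show ?thesis
    using additive_subgroup.zero_closed[OF T.is_additive_subgroup]
      additive_subgroup.a_closed[OF T.is_additive_subgroup]
    by (auto simp: linear_subspace_def)
qed

lemma relation_in_T_ideal:
  assumes "dist_two G x y" "dipath G (a @ [x])" "dipath G (y # b)"
  shows "(\<Sum>v\<in>middles G x y. basis_elem (a @ x # v # y # b)) \<in> T_ideal G"
proof -
  interpret T: ideal "T_ideal G :: ('a list \<Rightarrow>\<^sub>0 'b) set" "path_algebra G" by (rule ideal_T_ideal)
  have "t_elem G x y \<in> (T_ideal G :: ('a list \<Rightarrow>\<^sub>0 'b) set)"
    unfolding T_ideal_def using assms(1)
    by (intro subsetD[OF ring.genideal_self[OF ring_path_algebra]]) (auto simp: t_elem_closed)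
  then have "path_mult (basis_elem (a @ [x])) (t_elem G x y) \<in> (T_ideal G :: ('a list \<Rightarrow>\<^sub>0 'b) set)"
    using T.I_l_closed[of "t_elem G x y" "basis_elem (a @ [x])"] assms(2)
    by (simp add: supported_on_def)
  then have "path_mult (path_mult (basis_elem (a @ [x])) (t_elem G x y)) (basis_elem (y # b))
      \<in> (T_ideal G :: ('a list \<Rightarrow>\<^sub>0 'b) set)"
    using T.I_r_closed[of _ "basis_elem (y # b)"] assms(3) by (simp add: supported_on_def)
  then show ?thesis
    by (simp add: t_elem_eq path_mult_sum_left path_mult_sum_right concat_paths_def)
qed

end

section \<open>Path chains as annihilators of the relations\<close>

lemma lookup_regular_symbol:
  "Poly_Mapping.lookup (regular_symbol xs) z = of_bool (xs = z \<and> distinct_adj z)"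
  by (auto simp: regular_symbol_def lookup_single when_def)

lemma lookup_differential:
  assumes f: "f \<in> A_chains G (Suc m)"
  shows "Poly_Mapping.lookup (differential f) z =
    (\<Sum>xs\<in>Poly_Mapping.keys f. Poly_Mapping.lookup f xs *
      (\<Sum>i<length xs. (-1) ^ i * of_bool (take i xs @ drop (Suc i) xs = z \<and> distinct_adj z)))"
proof -
  have "\<not> length xs \<le> 1" if "xs \<in> Poly_Mapping.keys f" for xs
    using that f by (auto simp: A_chains_def supported_on_def n_paths_eq)
  then have "differential f = (\<Sum>xs\<in>Poly_Mapping.keys f. scale (Poly_Mapping.lookup f xs)
      (\<Sum>i<length xs. scale ((-1) ^ i) (regular_symbol (take i xs @ drop (Suc i) xs))))"
    unfolding differential_def by (intro sum.cong) simp_all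
  then show ?thesis
    by (simp add: lookup_sum lookup_regular_symbol)
qed

lemma not_successively_split:
  assumes "\<not> successively P z"
  shows "\<exists>a x y b. z = a @ x # y # b \<and> \<not> P x y"
  using assms
proof (induction P z rule: successively.induct)
  case (3 P x y xs)
  show ?case
  proof (cases "P x y")
    case True
    then obtain a x' y' b where "y # xs = a @ x' # y' # b" "\<not> P x' y'"
      using 3 by auto
    then show ?thesis
      by (intro exI[of _ "x # a"] exI[of _ x'] exI[of _ y'] exI[of _ b]) simp
  next
    case False
    then show ?thesis
      by (intro exI[of _ "[]"] exI[of _ x] exI[of _ y] exI[of _ xs]) simp
  qed
qed auto

lemma delete_creates_bad_step:
  assumes "successively P xs" "i < length xs"
    and del: "take i xs @ drop (Suc i) xs = a @ x # y # b" and bad: "\<not> P x y"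
  obtains v where "xs = a @ x # v # y # b" "i = Suc (length a)"
proof -
  define u t where "u = take i xs" and "t = drop (Suc i) xs"
  have xs: "xs = u @ xs ! i # t" and i: "length u = i"
    using assms(2) by (auto simp: u_def t_def id_take_nth_drop)
  have sp: "successively P u" "successively P t"
    using subst[of xs _ "successively P", OF xs assms(1)]
    by (auto simp: successively_append_iff successively_Cons)
  have ut: "u @ t = a @ x # y # b" using del by (simp add: u_def t_def)
  from ut consider c where "u @ c = a" "t = c @ x # y # b" | c where "u = a @ c" "c @ t = x # y # b"
    by (auto simp: append_eq_append_conv2)
  then show ?thesis
  proof cases
    case 1
    then show ?thesis using sp(2) bad by (simp add: successively_append_iff)
  next
    case 2
    show ?thesis
    proof (cases c)
      case Nil
      then show ?thesis using 2 sp(2) bad by simp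
    next
      case (Cons x' c')
      then have c: "c = x # c'" "c' @ t = y # b" using 2 by auto
      show ?thesis
      proof (cases c')
        case Nil
        then have u: "u = a @ [x]" and t: "t = y # b" using 2 c by simp_all
        have "xs = a @ x # xs ! i # y # b" by (rule trans[OF xs]) (simp add: u t)
        moreover have "i = Suc (length a)" using i u by simp
        ultimately show ?thesis by (rule that)
      next
        case (Cons y' c'')
        then show ?thesis using c 2 sp(1) bad by (simp add: successively_append_iff)
      qed
    qed
  qed
qed

context pair_digraph
begin

lemma dipath_distinct_adj: "dipath G p \<Longrightarrow> distinct_adj p"
  unfolding dipath_def distinct_adj_def
  by (rule successively_mono[of "\<lambda>x y. (x, y) \<in> parcs G"]) (auto dest: pair_no_loops)

lemma delete_from_dipath_iff:
  assumes "dipath G xs" "i < length xs" "(x, y) \<notin> parcs G"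
  shows "take i xs @ drop (Suc i) xs = a @ x # y # b \<longleftrightarrow>
    i = Suc (length a) \<and> xs \<in> (\<lambda>v. a @ x # v # y # b) ` middles G x y"
proof
  assume "take i xs @ drop (Suc i) xs = a @ x # y # b"
  with assms obtain v where "xs = a @ x # v # y # b" "i = Suc (length a)"
    by (auto simp: dipath_def elim: delete_creates_bad_step)
  with assms(1) show "i = Suc (length a) \<and> xs \<in> (\<lambda>v. a @ x # v # y # b) ` middles G x y"
    by (auto simp: dipath_middle_iff)
qed auto

lemma lookup_differential_at_gap:
  fixes f :: "'a list \<Rightarrow>\<^sub>0 'f::field"
  assumes f: "f \<in> A_chains G (Suc m)" and xy: "(x, y) \<notin> parcs G"
    and z: "distinct_adj (a @ x # y # b)"
  shows "Poly_Mapping.lookup (differential f) (a @ x # y # b) =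
    (-1) ^ Suc (length a) * (\<Sum>v\<in>middles G x y. Poly_Mapping.lookup f (a @ x # v # y # b))"
proof -
  let ?S = "(\<lambda>v. a @ x # v # y # b) ` middles G x y" and ?k = "Suc (length a)"
  have "(\<Sum>i<length xs. (-1) ^ i *
      of_bool (take i xs @ drop (Suc i) xs = a @ x # y # b \<and> distinct_adj (a @ x # y # b))) =
    (-1) ^ ?k * (of_bool (xs \<in> ?S) :: 'f)" if "xs \<in> Poly_Mapping.keys f" for xs
  proof -
    from that f have xs: "dipath G xs"
      by (auto simp: A_chains_def supported_on_def n_paths_eq)
    have "(\<Sum>i<length xs. (-1) ^ i *
        of_bool (take i xs @ drop (Suc i) xs = a @ x # y # b \<and> distinct_adj (a @ x # y # b))) =
      (\<Sum>i<length xs. if i = ?k then (-1) ^ ?k * of_bool (xs \<in> ?S) else (0::'f))"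
      by (rule sum.cong) (use delete_from_dipath_iff[OF xs _ xy] z in auto)
    then show ?thesis by auto
  qed
  then have "Poly_Mapping.lookup (differential f) (a @ x # y # b) =
      (\<Sum>xs\<in>Poly_Mapping.keys f. Poly_Mapping.lookup f xs * ((-1) ^ ?k * of_bool (xs \<in> ?S)))"
    unfolding lookup_differential[OF f] by (intro sum.cong) simp_all
  also have "\<dots> = (\<Sum>xs\<in>?S. (-1) ^ ?k * Poly_Mapping.lookup f xs)"
    by (rule sum.mono_neutral_cong) (auto simp: finite_middles in_keys_iff)
  also have "\<dots> = (-1) ^ ?k * (\<Sum>v\<in>middles G x y. Poly_Mapping.lookup f (a @ x # v # y # b))"
    by (subst sum.reindex) (auto simp: inj_on_def sum_distrib_left)
  finally show ?thesis .
qed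

lemma annihilates_relations_if_Omega_set:
  assumes f: "f \<in> Omega_set G n"
  shows "annihilates_relations G (Poly_Mapping.lookup f)"
  unfolding annihilates_relations_def
proof (intro allI impI)
  fix a x y b assume xy: "dist_two G x y"
  have A: "f \<in> A_chains G n" using f by (simp add: Omega_set_def)
  show "(\<Sum>v\<in>middles G x y. Poly_Mapping.lookup f (a @ x # v # y # b)) = 0"
  proof (rule ccontr)
    assume nonzero: "\<not> ?thesis"
    then obtain v where v: "Poly_Mapping.lookup f (a @ x # v # y # b) \<noteq> 0"
      by (meson sum.neutral)
    then have p: "a @ x # v # y # b \<in> n_paths G n"
      using A by (auto simp: A_chains_def supported_on_def in_keys_iff)
    then obtain m where m: "n = Suc m"
      by (cases n) (auto simp: n_paths_eq)
    from p xy have adj: "distinct_adj (a @ x # y # b)" and "a @ x # y # b \<notin> n_paths G m"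
      using dipath_distinct_adj[of "a @ [x]"] dipath_distinct_adj[of "y # b"]
      by (auto simp: n_paths_eq dipath_middle_iff dist_two_iff distinct_adj_def
          successively_append_iff successively_Cons dipath_def)
    moreover have "differential f \<in> A_chains G m"
      using f by (simp add: Omega_set_def m)
    ultimately have "Poly_Mapping.lookup (differential f) (a @ x # y # b) = 0"
      by (auto simp: A_chains_def supported_on_def in_keys_iff)
    then show False
      using lookup_differential_at_gap[OF A[unfolded m] _ adj] xy nonzero
      by (simp add: dist_two_iff)
  qed
qed

lemma Omega_set_if_annihilates_relations:
  assumes A: "f \<in> A_chains G n" and ann: "annihilates_relations G (Poly_Mapping.lookup f)"
  shows "f \<in> Omega_set G n"
proof -
  have "f \<in> R_chains G n"
    using A dipath_distinct_adj
    by (auto simp: A_chains_def R_chains_def supported_on_def regular_seqs_def n_paths_eq dipath_def)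
  moreover have "differential f \<in> (case n of 0 \<Rightarrow> {0} | Suc m \<Rightarrow> A_chains G m)"
  proof (cases n)
    case 0
    then have "length xs \<le> 1" if "xs \<in> Poly_Mapping.keys f" for xs
      using that A by (auto simp: A_chains_def supported_on_def n_paths_eq)
    then show ?thesis using 0 by (simp add: differential_def)
  next
    case (Suc m)
    note A = A[unfolded Suc]
    have "z \<in> n_paths G m" if z: "z \<in> Poly_Mapping.keys (differential f)" for z
    proof (rule ccontr)
      assume nz: "z \<notin> n_paths G m"
      from z have "Poly_Mapping.lookup (differential f) z \<noteq> 0" by (simp add: in_keys_iff)
      then have "(\<Sum>xs\<in>Poly_Mapping.keys f. Poly_Mapping.lookup f xs *
          (\<Sum>i<length xs. (-1) ^ i *
            of_bool (take i xs @ drop (Suc i) xs = z \<and> distinct_adj z))) \<noteq> 0"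
        unfolding lookup_differential[OF A] .
      then obtain xs where xs: "xs \<in> Poly_Mapping.keys f"
        and "Poly_Mapping.lookup f xs * (\<Sum>i<length xs. (-1) ^ i *
          of_bool (take i xs @ drop (Suc i) xs = z \<and> distinct_adj z)) \<noteq> 0"
        by (rule sum.not_neutral_contains_not_neutral)
      from this(2) have "(\<Sum>i<length xs. (-1) ^ i *
          of_bool (take i xs @ drop (Suc i) xs = z \<and> distinct_adj z)) \<noteq> (0::'b)"
        by auto
      then obtain i where i: "i < length xs" "take i xs @ drop (Suc i) xs = z"
        and adj: "distinct_adj z"
        by (rule sum.not_neutral_contains_not_neutral) auto
      from xs A have path: "dipath G xs" "length xs = Suc (Suc m)"
        by (auto simp: A_chains_def supported_on_def n_paths_eq)
      from i path have "length z = Suc m" by auto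
      moreover have "set z \<subseteq> set xs"
        unfolding i(2)[symmetric] using set_take_subset[of i xs] set_drop_subset[of "Suc i" xs]
        by simp
      then have "set z \<subseteq> pverts G" using path by (auto simp: dipath_def)
      ultimately have "\<not> successively (\<lambda>x y. (x, y) \<in> parcs G) z"
        using nz by (auto simp: n_paths_eq dipath_def)
      then obtain a x y b where z: "z = a @ x # y # b" and xy: "(x, y) \<notin> parcs G"
        using not_successively_split by blast
      from i(2) have "middles G x y \<noteq> {}"
        unfolding z delete_from_dipath_iff[OF path(1) i(1) xy] by auto
      then have "dist_two G x y"
        using adj xy by (auto simp: z dist_two_iff distinct_adj_def successively_append_iff)
      then have "Poly_Mapping.lookup (differential f) z = 0"
        using ann lookup_differential_at_gap[OF A xy adj[unfolded z]]
        by (simp add: z annihilates_relations_def)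
      then show False using \<open>Poly_Mapping.lookup (differential f) z \<noteq> 0\<close> by simp
    qed
    then show ?thesis by (auto simp: Suc A_chains_def supported_on_def)
  qed
  ultimately show ?thesis using A by (simp add: Omega_set_def)
qed

lemma Omega_set_eq:
  "Omega_set G n = {f \<in> A_chains G n. annihilates_relations G (Poly_Mapping.lookup f)}"
  using annihilates_relations_if_Omega_set Omega_set_if_annihilates_relations
  by (auto simp: Omega_set_def)

lemma linear_subspace_Omega_set: "linear_subspace (Omega_set G n)"
  using linear_subspace_supported_on[of "n_paths G n"]
  by (auto simp: Omega_set_eq A_chains_def linear_subspace_def annihilates_relations_def
      lookup_add sum.distrib sum_distrib_left[symmetric])

end

section \<open>Short moves and their classes\<close>

lemma split_at_middle:
  assumes "Suc (Suc j) < length p"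
  shows "p = take j p @ p ! j # p ! Suc j # p ! Suc (Suc j) # drop (Suc (Suc (Suc j))) p"
  using assms by (simp add: Cons_nth_drop_Suc)

lemma short_moves_iff:
  "(p, q) \<in> short_moves G n \<longleftrightarrow> p \<in> n_paths G n \<and> q \<in> n_paths G n \<and>
    (\<exists>a x v v' y b. p = a @ x # v # y # b \<and> q = a @ x # v' # y # b \<and> v \<noteq> v' \<and> dist_two G x y)"
    (is "_ \<longleftrightarrow> ?rhs")
proof
  assume "(p, q) \<in> short_moves G n"
  then obtain i where pq: "p \<in> n_paths G n" "q \<in> n_paths G n" "p \<noteq> q" and i: "0 < i" "i < n"
    and eq: "\<And>j. j \<le> n \<Longrightarrow> j \<noteq> i \<Longrightarrow> p ! j = q ! j"
    and d: "dist_two G (p ! (i - 1)) (p ! (i + 1))"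
    by (auto simp: short_moves_def)
  from i obtain j where j: "i = Suc j" by (cases i) auto
  have len: "length p = Suc n" "length q = Suc n" using pq by (auto simp: n_paths_eq)
  have "take j q = take j p" "drop (Suc (Suc (Suc j))) q = drop (Suc (Suc (Suc j))) p"
    using len i j by (auto intro!: nth_equalityI simp: eq)
  moreover have "q ! j = p ! j" "q ! Suc (Suc j) = p ! Suc (Suc j)"
    using i j by (auto simp: eq)
  ultimately have
    "p = take j p @ p ! j # p ! Suc j # p ! Suc (Suc j) # drop (Suc (Suc (Suc j))) p"
    "q = take j p @ p ! j # q ! Suc j # p ! Suc (Suc j) # drop (Suc (Suc (Suc j))) p"
    using split_at_middle[of j p] split_at_middle[of j q] len i j by auto
  moreover from this \<open>p \<noteq> q\<close> have "p ! Suc j \<noteq> q ! Suc j" by metis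
  moreover have "dist_two G (p ! j) (p ! Suc (Suc j))" using d j by simp
  ultimately show ?rhs using pq(1,2) by blast
next
  assume ?rhs
  then obtain a x v v' y b where pq: "p = a @ x # v # y # b" "q = a @ x # v' # y # b" "v \<noteq> v'"
    "dist_two G x y" and n: "p \<in> n_paths G n" "q \<in> n_paths G n"
    by blast
  have "p ! j = q ! j" if "j \<noteq> Suc (length a)" for j
    using that unfolding pq
    by (cases "j - length a") (auto simp: nth_append nth_Cons' split: if_splits)
  moreover have "p ! (Suc (length a) - 1) = x" "p ! (Suc (length a) + 1) = y"
    by (auto simp: pq nth_append)
  moreover have "Suc (length a) < n" using n by (auto simp: pq n_paths_eq)
  ultimately show "(p, q) \<in> short_moves G n"
    using n pq by (auto simp: short_moves_def intro!: exI[of _ "Suc (length a)"])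
qed

lemma thin_path_iff:
  "thin_path G n p \<longleftrightarrow>
    p \<in> n_paths G n \<and> (\<exists>a x v y b. p = a @ x # v # y # b \<and> thin_pair G x y)" (is "_ \<longleftrightarrow> ?rhs")
proof
  assume "thin_path G n p"
  then obtain i where p: "p \<in> n_paths G n" and i: "0 < i" "i < n"
    and t: "thin_pair G (p ! (i - 1)) (p ! (i + 1))"
    by (auto simp: thin_path_def)
  from i obtain j where j: "i = Suc j" by (cases i) auto
  have "p = take j p @ p ! j # p ! Suc j # p ! Suc (Suc j) # drop (Suc (Suc (Suc j))) p"
    using p i j by (intro split_at_middle) (auto simp: n_paths_eq)
  moreover have "thin_pair G (p ! j) (p ! Suc (Suc j))" using t j by simp
  ultimately show ?rhs using p by blast
next
  assume ?rhs
  then obtain a x v y b where p: "p = a @ x # v # y # b" "thin_pair G x y" "p \<in> n_paths G n"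
    by blast
  then show "thin_path G n p"
    unfolding thin_path_def
    by (auto simp: nth_append n_paths_eq intro!: exI[of _ "Suc (length a)"])
qed

lemma sym_short_moves: "sym (short_moves G n)"
  by (intro symI, unfold short_moves_iff) metis

lemma equiv_short_moves: "equiv (n_paths G n) (Restr ((short_moves G n)\<^sup>*) (n_paths G n))"
  using sym_rtrancl[OF sym_short_moves, of G n]
  by (intro equivI) (auto simp: refl_on_def sym_def trans_def)

lemma s_class_subset: "c \<in> s_classes G n \<Longrightarrow> c \<subseteq> n_paths G n"
  unfolding s_classes_def using Union_quotient[OF equiv_short_moves] by blast

lemma Union_s_classes: "\<Union>(s_classes G n) = n_paths G n"
  unfolding s_classes_def by (rule Union_quotient[OF equiv_short_moves])

lemma s_class_nonempty: "c \<in> s_classes G n \<Longrightarrow> c \<noteq> {}"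
  unfolding s_classes_def using in_quotient_imp_non_empty[OF equiv_short_moves] .

lemma s_classes_unique:
  "c \<in> s_classes G n \<Longrightarrow> d \<in> s_classes G n \<Longrightarrow> p \<in> c \<Longrightarrow> p \<in> d \<Longrightarrow> c = d"
  unfolding s_classes_def using quotient_disj[OF equiv_short_moves] by blast

lemma s_class_connected:
  "c \<in> s_classes G n \<Longrightarrow> p \<in> c \<Longrightarrow> q \<in> c \<Longrightarrow> (p, q) \<in> (short_moves G n)\<^sup>*"
  unfolding s_classes_def using in_quotient_imp_in_rel[OF equiv_short_moves] by blast

lemma s_class_closed:
  assumes "c \<in> s_classes G n" "p \<in> c" "(p, q) \<in> short_moves G n"
  shows "q \<in> c"
proof -
  have "(p, q) \<in> Restr ((short_moves G n)\<^sup>*) (n_paths G n)"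
    using assms(3) by (auto simp: short_moves_def)
  with assms(1,2) show ?thesis
    unfolding s_classes_def by (rule in_quotient_imp_closed[OF equiv_short_moves])
qed

lemma s_class_induct [consumes 3, case_names base step]:
  assumes c: "c \<in> s_classes G n" "p \<in> c" "q \<in> c"
    and base: "P p"
    and step: "\<And>q r. q \<in> c \<Longrightarrow> r \<in> c \<Longrightarrow> (q, r) \<in> short_moves G n \<Longrightarrow> P q \<Longrightarrow> P r"
  shows "P q"
proof -
  have "(p, q) \<in> (short_moves G n)\<^sup>*" using s_class_connected[OF c] .
  then have "q \<in> c \<and> P q"
    by (induction rule: rtrancl_induct) (use c base step s_class_closed[OF c(1)] in blast)+
  then show ?thesis ..
qed

lemma linear_subspace_path_degree: "linear_subspace (path_degree G n)"
  by (simp add: path_degree_def linear_subspace_supported_on)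

locale multisquare_free_digraph = pair_digraph +
  assumes no_multisquares: "no_multisquares G"
begin

lemma finite_s_classes: "finite (s_classes G n)"
  by (rule finite_subset[OF _ finite_Pow_iff[THEN iffD2, OF finite_n_paths[of n]]])
     (auto dest: s_class_subset)

lemma linear_subspace_T_degree: "linear_subspace (T_degree G n)"
  using linear_subspace_T_ideal linear_subspace_path_degree
  by (auto simp: T_degree_def linear_subspace_def)

lemma relation_in_T_degree:
  assumes "a @ x # v # y # b \<in> n_paths G n" "dist_two G x y"
  shows "(\<Sum>v\<in>middles G x y. basis_elem (a @ x # v # y # b)) \<in>
    (T_degree G n :: ('a list \<Rightarrow>\<^sub>0 'f::field) set)"
proof -
  have "a @ x # u # y # b \<in> n_paths G n" if "u \<in> middles G x y" for u
    using assms(1) that by (auto simp: n_paths_eq dipath_middle_iff)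
  then have "(\<Sum>v\<in>middles G x y. basis_elem (a @ x # v # y # b)) \<in>
      (path_degree G n :: ('a list \<Rightarrow>\<^sub>0 'f) set)"
    by (intro linear_subspace_sum linear_subspace_path_degree)
       (auto simp: path_degree_def supported_on_def)
  moreover have "dipath G (a @ [x])" "dipath G (y # b)"
    using assms(1) by (auto simp: n_paths_eq dipath_middle_iff)
  ultimately show ?thesis
    using relation_in_T_ideal[OF assms(2)] by (simp add: T_degree_def)
qed

lemma thin_path_in_T_degree:
  assumes "thin_path G n p"
  shows "basis_elem p \<in> T_degree G n"
proof -
  from assms obtain a x v y b where p: "p = a @ x # v # y # b" "p \<in> n_paths G n"
    and t: "dist_two G x y" "card (middles G x y) = 1"
    by (auto simp: thin_path_iff thin_pair_def card_two_paths)
  from p have "v \<in> middles G x y" by (simp add: n_paths_eq dipath_middle_iff)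
  then have "middles G x y = {v}" using t(2) by (auto simp: card_1_singleton_iff)
  with relation_in_T_degree[of a x v y b n] p t(1) show ?thesis by simp
qed

lemma middles_eq_pair:
  assumes "dist_two G x y" "v \<in> middles G x y" "u \<in> middles G x y" "v \<noteq> u"
  shows "middles G x y = {v, u}"
proof -
  have "card (middles G x y) \<le> 2"
    using no_multisquares assms by (simp add: no_multisquares_def card_two_paths)
  then show ?thesis
    using card_seteq[OF finite_middles, of "{v, u}" x y] assms by (auto simp: card_insert_if)
qed

lemma short_move_in_T_degree:
  assumes "(p, q) \<in> short_moves G n"
  shows "basis_elem p + basis_elem q \<in> T_degree G n"
proof -
  from assms obtain a x v v' y b where p: "p = a @ x # v # y # b" "p \<in> n_paths G n"
    and q: "q = a @ x # v' # y # b" "q \<in> n_paths G n" and d: "v \<noteq> v'" "dist_two G x y"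
    by (auto simp: short_moves_iff)
  from p q have "v \<in> middles G x y" "v' \<in> middles G x y"
    by (simp_all add: n_paths_eq dipath_middle_iff)
  then have "middles G x y = {v, v'}" using d by (intro middles_eq_pair)
  with relation_in_T_degree[of a x v y b n] p q d show ?thesis by simp
qed

lemma s_class_in_T_degree:
  assumes c: "c \<in> s_classes G n" and pq: "p \<in> c" "q \<in> c" 
    and p: "basis_elem p \<in> (T_degree G n :: ('a list \<Rightarrow>\<^sub>0 'f::field) set)"
  shows "basis_elem q \<in> (T_degree G n :: ('a list \<Rightarrow>\<^sub>0 'f) set)"
  using c pq
proof (induction rule: s_class_induct)
  case (step q r)
  from linear_subspace_diff[OF linear_subspace_T_degree short_move_in_T_degree[OF step(3)] step(4)]
  show ?case by simp
qed (rule p)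

lemma annihilates_relationsI:
  fixes w :: "'a list \<Rightarrow> 'f::field"
  assumes support: "\<And>p. w p \<noteq> 0 \<Longrightarrow> p \<in> n_paths G n"
    and thin: "\<And>p. thin_path G n p \<Longrightarrow> w p = 0"
    and move: "\<And>p q. (p, q) \<in> short_moves G n \<Longrightarrow> w p = - w q"
  shows "annihilates_relations G w"
  unfolding annihilates_relations_def
proof (intro allI impI)
  fix a x y b assume d: "dist_two G x y"
  show "(\<Sum>v\<in>middles G x y. w (a @ x # v # y # b)) = 0"
  proof (cases "\<exists>v\<in>middles G x y. w (a @ x # v # y # b) \<noteq> 0")
    case True
    then obtain v where v: "v \<in> middles G x y" "w (a @ x # v # y # b) \<noteq> 0" by blast
    from v(2) have p: "a @ x # v # y # b \<in> n_paths G n" by (rule support)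
    then have "\<not> thin_pair G x y"
      using thin v(2) unfolding thin_path_iff by blast
    then have "middles G x y \<noteq> {v}"
      using d by (auto simp: thin_pair_def card_two_paths)
    then obtain u where u: "u \<in> middles G x y" "u \<noteq> v" using v(1) by blast
    then have "a @ x # u # y # b \<in> n_paths G n"
      using p by (auto simp: n_paths_eq dipath_middle_iff)
    then have "(a @ x # v # y # b, a @ x # u # y # b) \<in> short_moves G n"
      using p d u unfolding short_moves_iff by blast
    then have "w (a @ x # v # y # b) = - w (a @ x # u # y # b)" by (rule move)
    then show ?thesis
      using middles_eq_pair[OF d v(1) u(1)] u(2) by auto
  qed (simp add: sum.neutral)
qed

end

section \<open>The pairing\<close>

lemma pairing_coset:
  assumes "linear_subspace W" "\<And>h. h \<in> W \<Longrightarrow> eval_on (Poly_Mapping.lookup w) h = 0"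
  shows "pairing w (W +>\<^bsub>subspace_of V\<^esub> f) = eval_on (Poly_Mapping.lookup w) f"
proof -
  have form: "(\<Sum>p\<in>Poly_Mapping.keys w. Poly_Mapping.lookup w p * Poly_Mapping.lookup g p) =
      eval_on (Poly_Mapping.lookup w) g" for g
    unfolding eval_on_lookup_commute[of w g] by (simp add: eval_on_def mult.commute)
  have const: "eval_on (Poly_Mapping.lookup w) g = eval_on (Poly_Mapping.lookup w) f"
    if "g \<in> W +>\<^bsub>subspace_of V\<^esub> f" for g
    using that assms(2) by (auto simp: coset_subspace_of eval_on_add)
  have self: "f \<in> W +>\<^bsub>subspace_of V\<^esub> f"
    using linear_subspace_zero[OF assms(1)] by (force simp: coset_subspace_of)
  show ?thesis
    unfolding pairing_def form
  proof (rule the_equality)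
    show "\<forall>g\<in>W +>\<^bsub>subspace_of V\<^esub> f.
        eval_on (Poly_Mapping.lookup w) f = eval_on (Poly_Mapping.lookup w) g"
      using const by metis
  qed (use self in blast)
qed

context multisquare_free_digraph
begin

lemma eval_on_T_degree:
  "w \<in> Omega_set G n \<Longrightarrow> h \<in> T_degree G n \<Longrightarrow> eval_on (Poly_Mapping.lookup w) h = 0"
  using eval_on_T_ideal by (auto simp: Omega_set_eq T_degree_def)

lemma pairing_coset_T_degree:
  assumes "w \<in> Omega_set G n"
  shows "pairing w (T_degree G n +>\<^bsub>subspace_of V\<^esub> f) = eval_on (Poly_Mapping.lookup w) f"
  by (rule pairing_coset[OF linear_subspace_T_degree eval_on_T_degree[OF assms]])

lemma pairing_path_coset:
  "w \<in> Omega_set G n \<Longrightarrow> pairing w (path_coset G n q) = Poly_Mapping.lookup w q"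
  by (simp add: path_coset_def pairing_coset_T_degree)

lemma carrier_Omega [simp]: "carrier (Omega G n) = Omega_set G n"
  and add_Omega [simp]: "add (Omega G n) = (+)"
  and smult_Omega [simp]: "smult (Omega G n) = scale"
  and zero_Omega [simp]: "zero (Omega G n) = 0"
  by (simp_all add: Omega_def)

lemma carrier_Omega_cochains:
  "carrier (Omega_cochains G n) =
    (\<lambda>f. T_degree G n +>\<^bsub>subspace_of (path_degree G n)\<^esub> f) ` path_degree G n"
  by (simp add: Omega_cochains_def quotient_carrier)

lemma pairing_cochains_add:
  assumes "w \<in> Omega_set G n" "X \<in> carrier (Omega_cochains G n)"
    "Y \<in> carrier (Omega_cochains G n)"
  shows "pairing w (X \<oplus>\<^bsub>Omega_cochains G n\<^esub> Y) = pairing w X + pairing w Y"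
  using assms unfolding carrier_Omega_cochains
  by (auto simp: Omega_cochains_def quotient_add linear_subspace_T_degree
      pairing_coset_T_degree eval_on_add)

lemma pairing_cochains_smult:
  assumes "w \<in> Omega_set G n" "X \<in> carrier (Omega_cochains G n)"
  shows "pairing w (a \<odot>\<^bsub>Omega_cochains G n\<^esub> X) = a * pairing w X"
  using assms unfolding carrier_Omega_cochains
  by (auto simp: Omega_cochains_def quotient_smult linear_subspace_T_degree
      pairing_coset_T_degree eval_on_scale)

lemma bilinear_form_pairing: "bilinear_form (Omega G n) (Omega_cochains G n) pairing"
proof -
  have "pairing (v + v') X = pairing v X + pairing v' X"
    if "v \<in> Omega_set G n" "v' \<in> Omega_set G n" "X \<in> carrier (Omega_cochains G n)"
    for v v' :: "'a list \<Rightarrow>\<^sub>0 'b" and X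
    using that linear_subspace_add[OF linear_subspace_Omega_set that(1,2)]
    by (auto simp: carrier_Omega_cochains pairing_coset_T_degree eval_on_lookup_commute eval_on_add)
  moreover have "pairing (scale a v) X = a * pairing v X"
    if "v \<in> Omega_set G n" "X \<in> carrier (Omega_cochains G n)"
    for a and v :: "'a list \<Rightarrow>\<^sub>0 'b" and X
    using that linear_subspace_scale[OF linear_subspace_Omega_set that(1)]
    by (auto simp: carrier_Omega_cochains pairing_coset_T_degree
        eval_on_lookup_commute[of "scale a v"] eval_on_lookup_commute[of v] eval_on_scale)
  ultimately show ?thesis
    by (simp add: bilinear_form_def pairing_cochains_add pairing_cochains_smult)
qed

lemma vectorspace_Omega:
  "vectorspace class_ring (Omega G n :: ('f::field, 'a list \<Rightarrow>\<^sub>0 'f) module)"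
  unfolding Omega_def by (rule vectorspace_subspace_of[OF linear_subspace_Omega_set])

lemma vectorspace_Omega_cochains:
  "vectorspace class_ring (Omega_cochains G n :: ('f::field, ('a list \<Rightarrow>\<^sub>0 'f) set) module)"
  unfolding Omega_cochains_def
  by (rule vectorspace_quotient_space[OF linear_subspace_path_degree linear_subspace_T_degree])

end

section \<open>Signed classes\<close>

text \<open>
  Both characteristics are instances of one situation: a set \<open>K\<close> of thick classes with signs
  \<open>\<sigma>\<close> that alternate along short moves, such that the paths outside \<open>K\<close> vanish modulo the
  relations.
\<close>

locale signed_classes = multisquare_free_digraph G
  for G :: "'a pair_pre_digraph" +
  fixes n :: nat and K :: "'a list set set" and \<sigma> :: "'a list \<Rightarrow> 'f::field"
  assumes thick: "K \<subseteq> thick_classes G n"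
    and sign_square: "p \<in> \<Union>K \<Longrightarrow> \<sigma> p * \<sigma> p = 1"
    and sign_move: "p \<in> \<Union>K \<Longrightarrow> (p, q) \<in> short_moves G n \<Longrightarrow> \<sigma> q = - \<sigma> p"
    and null: "p \<in> n_paths G n \<Longrightarrow> p \<notin> \<Union>K \<Longrightarrow>
      (basis_elem p :: 'a list \<Rightarrow>\<^sub>0 'f) \<in> T_degree G n"
begin

definition signed_sum :: "'a list set \<Rightarrow> 'a list \<Rightarrow>\<^sub>0 'f" where
  "signed_sum c = (\<Sum>p\<in>c. Poly_Mapping.single p (\<sigma> p))"

lemma K_classes: "c \<in> K \<Longrightarrow> c \<in> s_classes G n"
  using thick by (auto simp: thick_classes_def)

lemma K_subset: "c \<in> K \<Longrightarrow> c \<subseteq> n_paths G n"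
  using K_classes s_class_subset by blast

lemma K_unique: "c \<in> K \<Longrightarrow> d \<in> K \<Longrightarrow> p \<in> c \<Longrightarrow> p \<in> d \<Longrightarrow> c = d"
  using K_classes s_classes_unique by blast

lemma finite_K: "finite K"
  using K_classes finite_subset[OF _ finite_s_classes] by blast

lemma lookup_signed_sum:
  assumes "c \<in> K"
  shows "Poly_Mapping.lookup (signed_sum c) p = (if p \<in> c then \<sigma> p else 0)"
proof -
  have "finite c" using K_subset[OF assms] finite_subset finite_n_paths by blast
  then show ?thesis
    by (simp add: signed_sum_def lookup_sum lookup_single when_def)
qed

lemma signed_sum_in_Omega_set:
  assumes c: "c \<in> K"
  shows "signed_sum c \<in> Omega_set G n"
proof -
  have "signed_sum c \<in> A_chains G n"
    using K_subset[OF c]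
    by (auto simp: A_chains_def supported_on_def in_keys_iff lookup_signed_sum[OF c] split: if_splits)
  moreover have "annihilates_relations G (Poly_Mapping.lookup (signed_sum c))"
  proof (rule annihilates_relationsI)
    fix p q
    assume pq: "(p, q) \<in> short_moves G n"
    then have "p \<in> c \<longleftrightarrow> q \<in> c"
      using s_class_closed[OF K_classes[OF c]] symD[OF sym_short_moves] by metis
    then show "Poly_Mapping.lookup (signed_sum c) p = - Poly_Mapping.lookup (signed_sum c) q"
      using sign_move[OF UnionI[OF c] pq] by (simp add: lookup_signed_sum[OF c])
  qed (use c thick K_subset[OF c] in
      \<open>auto simp: lookup_signed_sum[OF c] thick_classes_def split: if_splits\<close>)
  ultimately show ?thesis by (simp add: Omega_set_eq)
qed

lemma signed_difference_in_T_degree: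
  assumes c: "c \<in> K" and pq: "p \<in> c" "q \<in> c"
  shows "Poly_Mapping.single q (\<sigma> q) - Poly_Mapping.single p (\<sigma> p) \<in> T_degree G n"
  using K_classes[OF c] pq
proof (induction rule: s_class_induct)
  case base
  show ?case by (simp add: linear_subspace_zero[OF linear_subspace_T_degree])
next
  case (step q r)
  have "\<sigma> r = - \<sigma> q" using sign_move[OF _ step(3)] step(1) c by blast
  then have "Poly_Mapping.single r (\<sigma> r) - Poly_Mapping.single p (\<sigma> p) =
      (Poly_Mapping.single q (\<sigma> q) - Poly_Mapping.single p (\<sigma> p)) -
      scale (\<sigma> q) (basis_elem q + basis_elem r)"
    by (simp add: scale_add_right single_uminus)
  then show ?case
    using linear_subspace_diff[OF linear_subspace_T_degree step(4)
        linear_subspace_scale[OF linear_subspace_T_degree short_move_in_T_degree[OF step(3)]],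
        of "\<sigma> q"]
    by (simp only:)
qed

definition rep :: "'a list set \<Rightarrow> 'a list" where
  "rep c = (SOME p. p \<in> c)"

lemma rep_in: "c \<in> K \<Longrightarrow> rep c \<in> c"
  unfolding rep_def using K_classes s_class_nonempty by (metis some_in_eq)

lemma sign_square_rep: "c \<in> K \<Longrightarrow> \<sigma> (rep c) * \<sigma> (rep c) = 1"
  using sign_square rep_in by blast

lemma reduce_to_representatives:
  assumes "f \<in> path_degree G n"
  shows "f - (\<Sum>c\<in>K. Poly_Mapping.single (rep c)
    (eval_on (Poly_Mapping.lookup (signed_sum c)) f * \<sigma> (rep c))) \<in> T_degree G n"
  using assms unfolding path_degree_def
proof (induction rule: supported_on_induct)
  case zero
  show ?case by (simp add: linear_subspace_zero[OF linear_subspace_T_degree])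
next
  case (single p a)
  let ?g = "\<lambda>c. Poly_Mapping.single (rep c)
    (eval_on (Poly_Mapping.lookup (signed_sum c)) (Poly_Mapping.single p a) * \<sigma> (rep c))"
  show ?case
  proof (cases "p \<in> \<Union>K")
    case True
    then obtain c where c: "c \<in> K" "p \<in> c" by blast
    have "(\<Sum>d\<in>K. ?g d) = (\<Sum>d\<in>K. if d = c then ?g c else 0)"
    proof (rule sum.cong)
      fix d assume d: "d \<in> K"
      then have "p \<in> d \<longleftrightarrow> d = c" using K_unique c by blast
      then show "?g d = (if d = c then ?g c else 0)"
        using d c by (simp add: lookup_signed_sum)
    qed simp
    then have "(\<Sum>d\<in>K. ?g d) = Poly_Mapping.single (rep c) (\<sigma> p * a * \<sigma> (rep c))"
      using c finite_K by (simp add: lookup_signed_sum)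
    moreover have "\<sigma> p * \<sigma> p = 1" using c sign_square by blast
    ultimately have "Poly_Mapping.single p a - (\<Sum>d\<in>K. ?g d) =
        scale (\<sigma> p * a) (Poly_Mapping.single p (\<sigma> p) - Poly_Mapping.single (rep c) (\<sigma> (rep c)))"
      by (intro poly_mapping_eqI) (auto simp: lookup_minus lookup_single when_def algebra_simps)
    then show ?thesis
      using signed_difference_in_T_degree[OF c(1) rep_in[OF c(1)] c(2)]
        linear_subspace_scale[OF linear_subspace_T_degree] by simp
  next
    case False
    then have "(\<Sum>d\<in>K. ?g d) = 0"
      by (intro sum.neutral) (auto simp: lookup_signed_sum)
    then show ?thesis
      using linear_subspace_scale[OF linear_subspace_T_degree null[OF single False], of a] by simp
  qed
next
  case (add f g)
  from linear_subspace_add[OF linear_subspace_T_degree add.IH] show ?case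
    by (simp add: eval_on_add distrib_right single_add sum.distrib algebra_simps)
qed

lemma in_T_degree_if_signed_sums_vanish:
  assumes "f \<in> path_degree G n"
    and "\<And>c. c \<in> K \<Longrightarrow> eval_on (Poly_Mapping.lookup (signed_sum c)) f = 0"
  shows "f \<in> T_degree G n"
  using reduce_to_representatives[OF assms(1)] assms(2) by simp

lemma is_basis_signed_sum: "is_basis (Omega G n) K signed_sum"
proof (rule is_basis_by_dual_family[OF vectorspace_Omega finite_K,
      where \<phi> = "\<lambda>c w. \<sigma> (rep c) * Poly_Mapping.lookup w (rep c)"])
  fix c d assume "c \<in> K" "d \<in> K"
  then show "\<sigma> (rep c) * Poly_Mapping.lookup (signed_sum d) (rep c) = of_bool (c = d)"
    using K_unique[of c d "rep c"] rep_in[of c]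
    by (auto simp: lookup_signed_sum sign_square_rep)
next
  fix w :: "'a list \<Rightarrow>\<^sub>0 'f"
  assume w: "w \<in> carrier (Omega G n)"
    and 0: "\<And>c. c \<in> K \<Longrightarrow> \<sigma> (rep c) * Poly_Mapping.lookup w (rep c) = 0"
  have "Poly_Mapping.lookup w p = 0" for p
  proof (cases "p \<in> n_paths G n")
    case True
    show ?thesis
    proof (cases "p \<in> \<Union>K")
      case True
      then obtain c where c: "c \<in> K" "p \<in> c" by blast
      have "eval_on (Poly_Mapping.lookup w)
          (Poly_Mapping.single p (\<sigma> p) - Poly_Mapping.single (rep c) (\<sigma> (rep c))) = 0"
        using w signed_difference_in_T_degree[OF c(1) rep_in[OF c(1)] c(2)]
        by (intro eval_on_T_degree) auto
      then have "Poly_Mapping.lookup w p * \<sigma> p = 0"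
        using 0[OF c(1)] by (auto simp: eval_on_diff)
      moreover have "\<sigma> p \<noteq> 0" using sign_square[OF True] by auto
      ultimately show ?thesis by simp
    next
      case False
      from eval_on_T_degree[OF _ null[OF \<open>p \<in> n_paths G n\<close> False], of w] w show ?thesis by simp
    qed
  next
    case False
    then show ?thesis
      using w by (auto simp: Omega_set_eq A_chains_def supported_on_def in_keys_iff)
  qed
  then show "w = \<zero>\<^bsub>Omega G n\<^esub>" by (auto intro: poly_mapping_eqI)
qed (auto simp: signed_sum_in_Omega_set lookup_add algebra_simps)

lemma nondegenerate_form_pairing:
  "nondegenerate_form (Omega G n) (Omega_cochains G n)
    (pairing :: ('a list \<Rightarrow>\<^sub>0 'f) \<Rightarrow> ('a list \<Rightarrow>\<^sub>0 'f) set \<Rightarrow> 'f)"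
proof -
  have "w = 0" if w: "w \<in> Omega_set G n"
    and 0: "\<And>X. X \<in> carrier (Omega_cochains G n) \<Longrightarrow> pairing w X = 0"
    for w :: "'a list \<Rightarrow>\<^sub>0 'f"
  proof (rule poly_mapping_eqI)
    fix p
    show "Poly_Mapping.lookup w p = Poly_Mapping.lookup 0 p"
    proof (cases "p \<in> n_paths G n")
      case True
      then have "path_coset G n p \<in> carrier (Omega_cochains G n)"
        unfolding path_coset_def carrier_Omega_cochains
        by (intro imageI) (auto simp: path_degree_def supported_on_def)
      from 0[OF this] w show ?thesis by (simp add: pairing_path_coset)
    next
      case False
      then show ?thesis
        using w by (auto simp: Omega_set_eq A_chains_def supported_on_def in_keys_iff)
    qed
  qed
  moreover have "X = \<zero>\<^bsub>Omega_cochains G n\<^esub>" if X: "X \<in> carrier (Omega_cochains G n)"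
    and 0: "\<And>w. w \<in> Omega_set G n \<Longrightarrow> pairing w X = (0::'f)" for X
  proof -
    from X obtain f where f: "f \<in> path_degree G n"
      "X = T_degree G n +>\<^bsub>subspace_of (path_degree G n)\<^esub> f"
      by (auto simp: carrier_Omega_cochains)
    have "f \<in> T_degree G n"
      using 0 signed_sum_in_Omega_set f
      by (intro in_T_degree_if_signed_sums_vanish) (auto simp: pairing_coset_T_degree)
    then show ?thesis
      by (simp add: f Omega_cochains_def quotient_zero coset_eq_iff[OF linear_subspace_T_degree])
  qed
  ultimately show ?thesis by (simp add: nondegenerate_form_def)
qed

lemma pairing_signed_sum:
  "c \<in> K \<Longrightarrow> pairing (signed_sum c) (path_coset G n q) = (if q \<in> c then \<sigma> q else 0)"
  by (simp add: pairing_path_coset signed_sum_in_Omega_set lookup_signed_sum)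

lemma is_basis_path_coset:
  assumes R: "complete_representatives K R"
  shows "is_basis (Omega_cochains G n :: ('f, ('a list \<Rightarrow>\<^sub>0 'f) set) module) R (path_coset G n)"
proof -
  have "\<exists>c. c \<in> K \<and> q \<in> c" if "q \<in> R" for q
    using that R by (auto simp: complete_representatives_def)
  then obtain cls where cls: "\<And>q. q \<in> R \<Longrightarrow> cls q \<in> K \<and> q \<in> cls q" by metis
  have R_paths: "R \<subseteq> n_paths G n" using cls K_subset by blast
  have same: "q = r" if "q \<in> R" "r \<in> R" "r \<in> cls q" for q r
  proof -
    from cls[OF that(1)] R have "\<exists>!q'. q' \<in> R \<inter> cls q"
      unfolding complete_representatives_def by blast
    with that cls[OF that(1)] show ?thesis by blast
  qed
  show ?thesis
  proof (rule is_basis_by_dual_family[OF vectorspace_Omega_cochains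
        finite_subset[OF R_paths finite_n_paths],
        where \<phi> = "\<lambda>q X. \<sigma> q * pairing (signed_sum (cls q)) X"])
    fix q assume "q \<in> R"
    then show "path_coset G n q \<in> carrier (Omega_cochains G n :: ('f, ('a list \<Rightarrow>\<^sub>0 'f) set) module)"
      unfolding path_coset_def carrier_Omega_cochains using R_paths
      by (intro imageI) (auto simp: path_degree_def supported_on_def)
  next
    fix q r assume "q \<in> R" "r \<in> R"
    then show "\<sigma> q * pairing (signed_sum (cls q)) (path_coset G n r) = of_bool (q = r)"
      using cls[of q] same[of q r] sign_square[of q] by (auto simp: pairing_signed_sum)
  next
    fix X assume X: "X \<in> carrier (Omega_cochains G n :: ('f, ('a list \<Rightarrow>\<^sub>0 'f) set) module)"
      and 0: "\<And>q. q \<in> R \<Longrightarrow> \<sigma> q * pairing (signed_sum (cls q)) X = 0"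
    from X obtain f where f: "f \<in> path_degree G n"
      "X = T_degree G n +>\<^bsub>subspace_of (path_degree G n)\<^esub> f"
      by (auto simp: carrier_Omega_cochains)
    have "eval_on (Poly_Mapping.lookup (signed_sum c)) f = 0" if c: "c \<in> K" for c
    proof -
      from c R obtain q where q: "q \<in> R" "q \<in> c" by (auto simp: complete_representatives_def)
      then have "cls q = c" using cls K_unique c by blast
      moreover have "\<sigma> q \<noteq> 0" using sign_square[OF UnionI[OF c q(2)]] by auto
      ultimately show ?thesis
        using 0[OF q(1)] c by (simp add: f(2) pairing_coset_T_degree signed_sum_in_Omega_set)
    qed
    then have "f \<in> T_degree G n"
      using f(1) by (intro in_T_degree_if_signed_sums_vanish)
    then show "X = \<zero>\<^bsub>Omega_cochains G n\<^esub>"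
      by (simp add: f Omega_cochains_def quotient_zero coset_eq_iff[OF linear_subspace_T_degree])
  qed (use cls in \<open>auto simp: pairing_cochains_add pairing_cochains_smult signed_sum_in_Omega_set
      algebra_simps\<close>)
qed

end

section \<open>The two characteristics\<close>

lemma minus_one_eq_one_if_CHAR_2:
  assumes "CHAR('f::field) = 2"
  shows "(-1::'f) = 1"
proof -
  have "of_nat 2 = (0::'f)" using of_nat_CHAR[where ?'a = 'f] assms by simp
  then have "(1::'f) + 1 = 0" by simp
  then show ?thesis by (simp add: minus_unique)
qed

lemma two_neq_zero_if_CHAR_neq_2:
  assumes "CHAR('f::field) \<noteq> 2"
  shows "(2::'f) \<noteq> 0"
proof
  assume "(2::'f) = 0"
  then have "of_nat 2 = (0::'f)" by simp
  then have "CHAR('f) dvd 2" by (simp only: of_nat_eq_0_iff_char_dvd)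
  then have "CHAR('f) = 1"
    using assms dvd_imp_le[of "CHAR('f)" 2] by (cases "CHAR('f)") (auto simp: le_Suc_eq)
  then show False using of_nat_CHAR[where ?'a = 'f] by simp
qed

context multisquare_free_digraph
begin

lemma in_T_degree_if_not_thick:
  assumes "p \<in> n_paths G n" "p \<notin> \<Union>(thick_classes G n)"
  shows "basis_elem p \<in> T_degree G n"
proof -
  from assms(1) obtain c where c: "c \<in> s_classes G n" "p \<in> c"
    using Union_s_classes by blast
  with assms(2) obtain q where "q \<in> c" "thin_path G n q"
    by (auto simp: thick_classes_def)
  with c show ?thesis
    by (blast intro: s_class_in_T_degree thin_path_in_T_degree)
qed

text \<open>
  Along short moves a path changes sign modulo the relations. If \<open>p\<close> does not vanish modulo the
  relations, the two possible signs therefore partition its class.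
\<close>

lemma in_T_degree_if_not_bipartite:
  assumes two: "(2::'f::field) \<noteq> 0" and c: "c \<in> s_classes G n" "p \<in> c"
    and nb: "\<not> bipartite_class G n c"
  shows "basis_elem p \<in> (T_degree G n :: ('a list \<Rightarrow>\<^sub>0 'f) set)"
proof (rule ccontr)
  assume p: "\<not> ?thesis"
  note T = linear_subspace_T_degree[of n, where ?'b = 'f]
  let ?e = "basis_elem :: 'a list \<Rightarrow> 'a list \<Rightarrow>\<^sub>0 'f"
  let ?T = "T_degree G n :: ('a list \<Rightarrow>\<^sub>0 'f) set"
  define A where "A = {q \<in> c. ?e q - ?e p \<in> ?T}"
  define B where "B = {q \<in> c. ?e q + ?e p \<in> ?T}"
  have twice: False if "?e p + ?e p \<in> ?T"
  proof -
    have "?e p = scale (1 / 2) (?e p + ?e p)"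
      using two by (simp add: scale_add_right single_add[symmetric])
    with linear_subspace_scale[OF T that, of "1 / 2"] p show False by simp
  qed
  have "q \<in> A \<union> B" if "q \<in> c" for q
    using c that
  proof (induction rule: s_class_induct)
    case base
    show ?case using c linear_subspace_zero[OF T] by (simp add: A_def)
  next
    case (step q r)
    note move = short_move_in_T_degree[OF step(3), where ?'b = 'f]
    from step(4) show ?case
    proof
      assume "q \<in> A"
      then have "(?e q + ?e r) - (?e q - ?e p) \<in> ?T"
        using linear_subspace_diff[OF T move, of "?e q - ?e p"] by (simp add: A_def)
      then show ?thesis using step(2) by (simp add: B_def)
    next
      assume "q \<in> B"
      then have "(?e q + ?e r) - (?e q + ?e p) \<in> ?T"
        using linear_subspace_diff[OF T move, of "?e q + ?e p"] by (simp add: B_def)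
      then show ?thesis using step(2) by (simp add: A_def)
    qed
  qed
  then have "A \<union> B = c" by (auto simp: A_def B_def)
  moreover have "A \<inter> B = {}"
  proof -
    have False if "q \<in> A" "q \<in> B" for q
    proof -
      have "(?e q + ?e p) - (?e q - ?e p) \<in> ?T"
        using that linear_subspace_diff[OF T, of "?e q + ?e p" "?e q - ?e p"]
        by (simp add: A_def B_def)
      then show False using twice by simp
    qed
    then show ?thesis by blast
  qed
  moreover have "(q, r) \<notin> short_moves G n" if "q \<in> A" "r \<in> A" for q r
  proof
    assume "(q, r) \<in> short_moves G n"
    note move = short_move_in_T_degree[OF this, where ?'b = 'f]
    have "?e q - ?e p \<in> ?T" "?e r - ?e p \<in> ?T" using that by (simp_all add: A_def)
    from linear_subspace_diff[OF T linear_subspace_diff[OF T move this(1)] this(2)]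
    show False using twice by simp
  qed
  moreover have "(q, r) \<notin> short_moves G n" if "q \<in> B" "r \<in> B" for q r
  proof
    assume "(q, r) \<in> short_moves G n"
    note move = short_move_in_T_degree[OF this, where ?'b = 'f]
    have "?e q + ?e p \<in> ?T" "?e r + ?e p \<in> ?T" using that by (simp_all add: B_def)
    from linear_subspace_diff[OF T linear_subspace_add[OF T this] move]
    show False using twice by (simp add: algebra_simps)
  qed
  ultimately have "bipartition G n c A B" by (simp add: bipartition_def)
  with nb show False by (auto simp: bipartite_class_def)
qed

lemma signed_classes_CHAR_2:
  assumes "CHAR('f::field) = 2"
  shows "signed_classes G n (thick_classes G n) (\<lambda>_. 1::'f)"
  using minus_one_eq_one_if_CHAR_2[OF assms] in_T_degree_if_not_thick
  by unfold_locales auto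

lemma signed_classes_CHAR_neq_2:
  assumes char: "CHAR('f::field) \<noteq> 2"
    and part: "\<And>c. c \<in> thick_bipartite_classes G n \<Longrightarrow> bipartition G n c (cpos c) (cneg c)"
  shows "signed_classes G n (thick_bipartite_classes G n)
    (\<lambda>p. if p \<in> \<Union>(cpos ` thick_bipartite_classes G n) then 1 else -1::'f)"
proof unfold_locales
  let ?K = "thick_bipartite_classes G n"
  have K: "c \<in> s_classes G n" if "c \<in> ?K" for c
    using that by (auto simp: thick_bipartite_classes_def thick_classes_def)
  have sub: "cpos c \<subseteq> c" if "c \<in> ?K" for c
    using part[OF that] by (auto simp: bipartition_def)
  have pos: "p \<in> \<Union>(cpos ` ?K) \<longleftrightarrow> p \<in> cpos c" if "c \<in> ?K" "p \<in> c" for c p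
    using that sub s_classes_unique[OF K K] by blast
  show "?K \<subseteq> thick_classes G n" by (auto simp: thick_bipartite_classes_def)
  fix p q assume "p \<in> \<Union>?K" and pq: "(p, q) \<in> short_moves G n"
  then obtain c where c: "c \<in> ?K" "p \<in> c" by blast
  have q: "q \<in> c" using s_class_closed[OF K[OF c(1)] c(2) pq] .
  have "p \<in> cpos c \<longleftrightarrow> q \<notin> cpos c"
    using part[OF c(1)] c(2) q pq unfolding bipartition_def by blast
  then show "(if q \<in> \<Union>(cpos ` ?K) then 1 else -1::'f) =
      - (if p \<in> \<Union>(cpos ` ?K) then 1 else -1)"
    unfolding pos[OF c] pos[OF c(1) q] by auto
next
  fix p assume p: "p \<in> n_paths G n" "p \<notin> \<Union>(thick_bipartite_classes G n)"
  show "basis_elem p \<in> (T_degree G n :: ('a list \<Rightarrow>\<^sub>0 'f) set)"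
  proof (cases "p \<in> \<Union>(thick_classes G n)")
    case True
    then obtain c where "c \<in> thick_classes G n" "p \<in> c" by blast
    with p(2) show ?thesis
      by (intro in_T_degree_if_not_bipartite[OF two_neq_zero_if_CHAR_neq_2[OF char], of c])
         (auto simp: thick_bipartite_classes_def thick_classes_def)
  qed (rule in_T_degree_if_not_thick[OF p(1)])
qed auto

end

lemma is_basis_cong:
  assumes "\<And>i. i \<in> I \<Longrightarrow> v i = v' i"
  shows "is_basis M I v = is_basis M I v'"
  unfolding is_basis_def using assms by (simp cong: inj_on_cong image_cong)

theorem theorem4p7:
  fixes G :: "'a pair_pre_digraph"
    and n :: nat
    and cpos cneg :: "'a list set \<Rightarrow> 'a list set"
  assumes "pair_digraph G"
    and "no_multisquares G"
    and "\<And>c. c \<in> thick_bipartite_classes G n \<Longrightarrow> bipartition G n c (cpos c) (cneg c)"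
  shows
    "(CHAR('f::field) = 2 \<longrightarrow>
       is_basis (Omega G n :: ('f, 'a list \<Rightarrow>\<^sub>0 'f) module) (thick_classes G n) s'_elem) \<and>
     (CHAR('f) \<noteq> 2 \<longrightarrow>
       is_basis (Omega G n :: ('f, 'a list \<Rightarrow>\<^sub>0 'f) module)
         (thick_bipartite_classes G n) (\<lambda>c. s_elem (cpos c) (cneg c))) \<and>
     bilinear_form (Omega G n :: ('f, 'a list \<Rightarrow>\<^sub>0 'f) module) (Omega_cochains G n) pairing \<and>
     nondegenerate_form (Omega G n :: ('f, 'a list \<Rightarrow>\<^sub>0 'f) module) (Omega_cochains G n) pairing \<and>
     (\<forall>w \<in> carrier (Omega G n :: ('f, 'a list \<Rightarrow>\<^sub>0 'f) module). \<forall>q \<in> n_paths G n.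
       pairing w (path_coset G n q) =
         (\<Sum>p\<in>n_paths G n. Poly_Mapping.lookup w p * of_bool (p = q))) \<and>
     (CHAR('f) = 2 \<longrightarrow>
       (\<forall>R. complete_representatives (thick_classes G n) R \<longrightarrow>
         is_basis (Omega_cochains G n :: ('f, ('a list \<Rightarrow>\<^sub>0 'f) set) module) R (path_coset G n) \<and>
         (\<forall>c \<in> thick_classes G n. \<forall>q \<in> R.
           pairing (s'_elem c) (path_coset G n q) = (of_bool (q \<in> c) :: 'f)))) \<and>
     (CHAR('f) \<noteq> 2 \<longrightarrow>
       (\<forall>R. complete_representatives (thick_bipartite_classes G n) R \<longrightarrow>
         is_basis (Omega_cochains G n :: ('f, ('a list \<Rightarrow>\<^sub>0 'f) set) module) R (path_coset G n) \<and>
         (\<forall>c \<in> thick_bipartite_classes G n. \<forall>q \<in> R.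
           pairing (s_elem (cpos c) (cneg c)) (path_coset G n q) =
             (of_bool (q \<in> cpos c) - of_bool (q \<in> cneg c) :: 'f)) \<and>
         (R \<subseteq> \<Union>(cpos ` thick_bipartite_classes G n) \<longrightarrow>
           (\<forall>c \<in> thick_bipartite_classes G n. \<forall>q \<in> R.
             pairing (s_elem (cpos c) (cneg c)) (path_coset G n q) = (of_bool (q \<in> c) :: 'f)))))"
proof -
  interpret multisquare_free_digraph G
    using assms by (simp add: multisquare_free_digraph_def multisquare_free_digraph_axioms_def)
  have pairing_sum: "pairing w (path_coset G n q) =
      (\<Sum>p\<in>n_paths G n. Poly_Mapping.lookup w p * of_bool (p = q))"
    if "w \<in> carrier (Omega G n)" "q \<in> n_paths G n" for w :: "'a list \<Rightarrow>\<^sub>0 'f" and q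
    using that finite_n_paths by (simp add: pairing_path_coset)
  show ?thesis
  proof (cases "CHAR('f) = 2")
    case True
    interpret S: signed_classes G n "thick_classes G n" "\<lambda>_. 1::'f"
      by (rule signed_classes_CHAR_2[OF True])
    have elem: "s'_elem c = S.signed_sum c" for c
      by (simp add: S.signed_sum_def s'_elem_def)
    show ?thesis
      using True S.is_basis_signed_sum bilinear_form_pairing S.nondegenerate_form_pairing
        S.is_basis_path_coset pairing_sum
      by (simp add: elem S.pairing_signed_sum of_bool_def cong: is_basis_cong)
  next
    case False
    let ?K = "thick_bipartite_classes G n"
    let ?\<sigma> = "\<lambda>p. if p \<in> \<Union>(cpos ` ?K) then 1 else -1::'f"
    interpret S: signed_classes G n ?K ?\<sigma>
      by (rule signed_classes_CHAR_neq_2[OF False assms(3)])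
    have part: "cpos c \<union> cneg c = c" "cpos c \<inter> cneg c = {}" if "c \<in> ?K" for c
      using assms(3)[OF that] by (auto simp: bipartition_def)
    have pos: "p \<in> \<Union>(cpos ` ?K) \<longleftrightarrow> p \<in> cpos c" if "c \<in> ?K" "p \<in> c" for c p
      using that part S.K_unique by blast
    have elem: "s_elem (cpos c) (cneg c) = S.signed_sum c" if c: "c \<in> ?K" for c
    proof -
      have "finite c" using S.K_subset[OF c] finite_subset finite_n_paths by blast
      then have fin: "finite (cpos c)" "finite (cneg c)" using part(1)[OF c] by (metis finite_Un)+
      show ?thesis
      proof (rule poly_mapping_eqI)
        fix p
        show "Poly_Mapping.lookup (s_elem (cpos c) (cneg c)) p =
            Poly_Mapping.lookup (S.signed_sum c) p"
          unfolding S.lookup_signed_sum[OF c] using part[OF c] pos[OF c, of p] fin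
          by (auto simp: s_elem_def lookup_minus lookup_sum_basis_elem)
      qed
    qed
    have basis: "is_basis (Omega G n :: ('f, 'a list \<Rightarrow>\<^sub>0 'f) module) ?K
        (\<lambda>c. s_elem (cpos c) (cneg c))"
      using S.is_basis_signed_sum by (simp add: elem cong: is_basis_cong)
    have dual: "pairing (s_elem (cpos c) (cneg c)) (path_coset G n q) =
        (of_bool (q \<in> cpos c) - of_bool (q \<in> cneg c) :: 'f)" if c: "c \<in> ?K" for c q
      unfolding elem[OF c] S.pairing_signed_sum[OF c]
      using part[OF c] pos[OF c, of q] by auto
    have dual_pos: "pairing (s_elem (cpos c) (cneg c)) (path_coset G n q) = (of_bool (q \<in> c) :: 'f)"
      if "c \<in> ?K" "q \<in> \<Union>(cpos ` ?K)" for c q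
      unfolding dual[OF that(1)] using part[OF that(1)] pos[OF that(1), of q] that(2) by auto
    show ?thesis
      by (intro conjI impI allI ballI;
          (erule notE[OF False] |
            (rule basis bilinear_form_pairing S.nondegenerate_form_pairing
              S.is_basis_path_coset pairing_sum dual_pos dual;
              (assumption | erule (1) subsetD))))
  qed
qed

end
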